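(* The joint spectral measure $\nu_{x,y}$ (over $\mathfrak{D}_{x,y}$) of the pair of graphs ${}^W\mathcal{A}^{\rho_x}_{\infty}(Sp(2))$, ${}^W\mathcal{A}^{\rho_y}_{\infty}(Sp(2))$ is $$\mathrm{d}\nu_{x,y}(x,y) = 8\,|J_{x,y}(x,y)|^{-1}\,\mathrm{d}x\,\mathrm{d}y,$$ and the joint spectral measure $\nu_{y,z}$ (over $\mathfrak{D}_{y,z}$) of the pair of graphs ${}^W\mathcal{A}^{\rho_y}_{\infty}(Sp(2))$, ${}^W\mathcal{A}^{\rho_z}_{\infty}(Sp(2))$ is $$\mathrm{d}\nu_{y,z}(y,z) = 16\,|J_{y,z}(y,z)|^{-1}\,\mathrm{d}y\,\mathrm{d}z.$$
   Context: Let $\rho_x,\rho_y,\rho_z$ be the irreducible representations of $Sp(2)$ (the group of $4\times 4$ unitary symplectic matrices) of dimensions $4$, $5$, $10$ respectively: the standard representation, the one with image $SO(5)$, and the adjoint representation. Their characters restricted to the maximal torus $\mathbb{T}^2$ are $\chi_{\rho_x}(\omega_1,\omega_2)=\omega_1+\omega_1^{-1}+\omega_2+\omega_2^{-1}$, $\chi_{\rho_y}(\omega_1,\omega_2)=1+\omega_1\omega_2+\omega_1^{-1}\omega_2^{-1}+\omega_1\omega_2^{-1}+\omega_1^{-1}\omega_2$, $\chi_{\rho_z}(\omega_1,\omega_2)=2+\omega_1^2+\omega_1^{-2}+\omega_2^2+\omega_2^{-2}+\omega_1\omega_2+\omega_1^{-1}\omega_2^{-1}+\omega_1\omega_2^{-1}+\omega_1^{-1}\omega_2$.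 For $u\in\{x,y,z\}$, the graph ${}^W\mathcal{A}^{\rho_u}_{\infty}(Sp(2))$ has vertex set $\mathbb{Z}^2$, and the number of edges from $(\mu_1,\mu_2)$ to $(\mu_1+a,\mu_2+b)$ is the coefficient of $\omega_1^a\omega_2^b$ in $\chi_{\rho_u}(\omega_1,\omega_2)$. Let $\Delta_u$ be its adjacency operator on $\ell^2(\mathbb{Z}^2)$ (the operators $\Delta_x,\Delta_y,\Delta_z$ are bounded, self-adjoint and commute), and let $e_{(0,0)}$ be the basis vector of the vertex $(0,0)$. For $u,v\in\{x,y,z\}$ let $\mathfrak{D}_{u,v}=\{(\chi_{\rho_u}(\omega_1,\omega_2),\chi_{\rho_v}(\omega_1,\omega_2)) : (\omega_1,\omega_2)\in\mathbb{T}^2\}\subset\mathbb{R}^2$. The joint spectral measure of the pair of graphs for $\rho_u,\rho_v$ is the unique measure $\nu_{u,v}$ on $\mathfrak{D}_{u,v}$ with $$\int_{\mathfrak{D}_{u,v}} s^m t^n\,\mathrm{d}\nu_{u,v}(s,t)=\langle \Delta_u^m\Delta_v^n e_{(0,0)},e_{(0,0)}\rangle\quad\text{for all } m,n\ge 0.$$ With $\omega_j=e^{2\pi i\theta_j}$, $J_{x,y}=\det(\partial(x,y)/\partial(\theta_1,\theta_2))$ and $J_{y,z}=\det(\partial(y,z)/\partial(\theta_1,\theta_2))$ denote the Jacobians of the changes of variables $(x,y)=(\chi_{\rho_x},\chi_{\rho_y})$, $(y,z)=(\chi_{\rho_y},\chi_{\rho_z})$; their absolute values, as functions on $\mathfrak{D}_{x,y}$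 and $\mathfrak{D}_{y,z}$, are $$|J_{x,y}(x,y)|=4\pi^2\sqrt{(y+2x+3)(y-2x+3)(x^2-4y+4)},$$ $$|J_{y,z}(y,z)|=8\pi^2\sqrt{(z-3y+5)(z+y+1)(y^2+2y+5-4z)}.$$ *)

theory Defs
  imports "HOL-Analysis.Analysis" "HOL-Library.Poly_Mapping"
begin

datatype irrep = Rho_x | Rho_y | Rho_z

text \<open>
  The irreducible representations of \<open>Sp(2)\<close> of dimension 4 (standard), 5 (with image \<open>SO(5)\<close>)
  and 10 (adjoint) enter only through their characters. A character, restricted to the maximal
  torus, is a Laurent polynomial in \<open>\<omega>\<^sub>1, \<omega>\<^sub>2\<close>. It is encoded by its coefficients: \<open>single (a, b) n\<close> stands for
  \<open>n \<omega>\<^sub>1\<^sup>a \<omega>\<^sub>2\<^sup>b\<close>.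
\<close>

fun weights :: "irrep \<Rightarrow> ((int \<times> int) \<Rightarrow>\<^sub>0 nat)" where
  "weights Rho_x =
     Poly_Mapping.single (1, 0) 1 + Poly_Mapping.single (-1, 0) 1
     + Poly_Mapping.single (0, 1) 1 + Poly_Mapping.single (0, -1) 1"
| "weights Rho_y =
     Poly_Mapping.single (0, 0) 1
     + Poly_Mapping.single (1, 1) 1 + Poly_Mapping.single (-1, -1) 1
     + Poly_Mapping.single (1, -1) 1 + Poly_Mapping.single (-1, 1) 1"
| "weights Rho_z =
     Poly_Mapping.single (0, 0) 2
     + Poly_Mapping.single (2, 0) 1 + Poly_Mapping.single (-2, 0) 1
     + Poly_Mapping.single (0, 2) 1 + Poly_Mapping.single (0, -2) 1
     + Poly_Mapping.single (1, 1) 1 + Poly_Mapping.single (-1, -1) 1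
     + Poly_Mapping.single (1, -1) 1 + Poly_Mapping.single (-1, 1) 1"

definition laurent_eval :: "((int \<times> int) \<Rightarrow>\<^sub>0 nat) \<Rightarrow> complex \<Rightarrow> complex \<Rightarrow> complex" where
  "laurent_eval p w1 w2 =
     (\<Sum>(a, b)\<in>Poly_Mapping.keys p. of_nat (Poly_Mapping.lookup p (a, b)) * w1 powi a * w2 powi b)"

definition character :: "irrep \<Rightarrow> complex \<Rightarrow> complex \<Rightarrow> complex" where
  "character u = laurent_eval (weights u)"

lemma laurent_eval_superset:
  assumes "finite S" "Poly_Mapping.keys p \<subseteq> S"
  shows "laurent_eval p w1 w2 =
     (\<Sum>(a, b)\<in>S. of_nat (Poly_Mapping.lookup p (a, b)) * w1 powi a * w2 powi b)"
  unfolding laurent_eval_def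
  by (rule sum.mono_neutral_left) (use assms in \<open>auto simp: in_keys_iff\<close>)

lemma laurent_eval_add:
  "laurent_eval (p + q) w1 w2 = laurent_eval p w1 w2 + laurent_eval q w1 w2"
proof -
  let ?S = "Poly_Mapping.keys p \<union> Poly_Mapping.keys q"
  have "Poly_Mapping.keys (p + q) \<subseteq> ?S"
    by (rule keys_add)
  then show ?thesis
    by (simp add: laurent_eval_superset[of ?S] lookup_add case_prod_unfold
        sum.distrib[symmetric] algebra_simps)
qed

lemma laurent_eval_single:
  "laurent_eval (Poly_Mapping.single (a, b) n) w1 w2 = of_nat n * w1 powi a * w2 powi b"
  by (simp add: laurent_eval_superset[of "{(a, b)}"])

lemma character_Rho_x:
  "character Rho_x w1 w2 = w1 + inverse w1 + w2 + inverse w2"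
  by (simp add: character_def laurent_eval_add laurent_eval_single power_int_minus)

lemma character_Rho_y:
  "character Rho_y w1 w2 =
     1 + w1 * w2 + inverse w1 * inverse w2 + w1 * inverse w2 + inverse w1 * w2"
  by (simp add: character_def laurent_eval_add laurent_eval_single power_int_minus)

lemma character_Rho_z:
  "character Rho_z w1 w2 =
     2 + w1\<^sup>2 + inverse (w1\<^sup>2) + w2\<^sup>2 + inverse (w2\<^sup>2)
     + w1 * w2 + inverse w1 * inverse w2 + w1 * inverse w2 + inverse w1 * w2"
  by (simp add: character_def laurent_eval_add laurent_eval_single power_int_minus)

lemma character_real_on_torus:
  assumes "norm w1 = 1" "norm w2 = 1"
  shows "Im (character u w1 w2) = 0"
proof -
  have i: "inverse w1 = cnj w1" "inverse w2 = cnj w2"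
    using assms by (auto simp: inverse_eq_divide divide_conv_cnj)
  show ?thesis
    by (cases u)
      (simp_all add: character_Rho_x character_Rho_y character_Rho_z power_inverse[symmetric] i
        power2_eq_square)
qed

definition num_edges :: "irrep \<Rightarrow> int \<times> int \<Rightarrow> int \<times> int \<Rightarrow> nat" where
  "num_edges u \<mu> \<nu> = Poly_Mapping.lookup (weights u) (\<nu> - \<mu>)"

definition ell2 :: "('v \<Rightarrow> complex) set" where
  "ell2 = {f. (\<lambda>v. (cmod (f v))\<^sup>2) summable_on UNIV}"

definition ell2_inner :: "('v \<Rightarrow> complex) \<Rightarrow> ('v \<Rightarrow> complex) \<Rightarrow> complex" where
  "ell2_inner f g = (\<Sum>\<^sub>\<infinity>v. f v * cnj (g v))"

definition ell2_basis :: "'v \<Rightarrow> 'v \<Rightarrow> complex" where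
  "ell2_basis w = (\<lambda>v. if v = w then 1 else 0)"

text \<open>
  The sum below has only finitely many nonzero terms, so the formula makes sense for every
  function on the vertices; the operator preserves \<open>ell2\<close> (see \<open>adjacency_op_ell2\<close>).
\<close>

definition adjacency_op :: "irrep \<Rightarrow> (int \<times> int \<Rightarrow> complex) \<Rightarrow> (int \<times> int \<Rightarrow> complex)" where
  "adjacency_op u f = (\<lambda>\<mu>. \<Sum>\<^sub>\<infinity>\<nu>. of_nat (num_edges u \<mu> \<nu>) * f \<nu>)"

lemma adjacency_op_eq_sum:
  "adjacency_op u f \<mu> =
     (\<Sum>d\<in>Poly_Mapping.keys (weights u). of_nat (Poly_Mapping.lookup (weights u) d) * f (\<mu> + d))"
proof -
  let ?K = "Poly_Mapping.keys (weights u)"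
  have "adjacency_op u f \<mu> = (\<Sum>\<^sub>\<infinity>\<nu>\<in>(+) \<mu> ` ?K. of_nat (num_edges u \<mu> \<nu>) * f \<nu>)"
    unfolding adjacency_op_def
  proof (rule infsum_cong_neutral)
    fix \<nu> assume "\<nu> \<in> UNIV - (+) \<mu> ` ?K"
    then have "\<nu> - \<mu> \<notin> ?K"
      by (metis DiffD2 add_diff_cancel_left' diff_add_cancel add.commute image_eqI)
    then show "of_nat (num_edges u \<mu> \<nu>) * f \<nu> = 0"
      by (simp add: num_edges_def in_keys_iff)
  qed auto
  also have "\<dots> = (\<Sum>\<nu>\<in>(+) \<mu> ` ?K. of_nat (num_edges u \<mu> \<nu>) * f \<nu>)"
    by simp
  also have "\<dots> = (\<Sum>d\<in>?K. of_nat (num_edges u \<mu> (\<mu> + d)) * f (\<mu> + d))"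
    by (subst sum.reindex) auto
  finally show ?thesis
    by (simp add: num_edges_def)
qed

lemma ell2_basis_ell2: "ell2_basis w \<in> ell2"
proof -
  have "(\<lambda>v. (cmod (ell2_basis w v))\<^sup>2) summable_on {w}"
    by simp
  also have "?this \<longleftrightarrow> (\<lambda>v. (cmod (ell2_basis w v))\<^sup>2) summable_on UNIV"
    by (rule summable_on_cong_neutral) (auto simp: ell2_basis_def)
  finally show ?thesis
    by (simp add: ell2_def)
qed

lemma summable_on_finite_sum:
  fixes g :: "'i \<Rightarrow> 'a \<Rightarrow> real"
  assumes "\<And>i. i \<in> I \<Longrightarrow> g i summable_on A"
  shows "(\<lambda>x. \<Sum>i\<in>I. g i x) summable_on A"
  using assms by (induction I rule: infinite_finite_induct) (auto intro: summable_on_add)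

lemma adjacency_op_ell2:
  assumes "f \<in> ell2"
  shows "adjacency_op u f \<in> ell2"
proof -
  let ?K = "Poly_Mapping.keys (weights u)" and ?c = "Poly_Mapping.lookup (weights u)"
  let ?C = "\<Sum>d\<in>?K. (real (?c d))\<^sup>2"
  have shift: "(\<lambda>\<mu>. (cmod (f (\<mu> + d)))\<^sup>2) summable_on UNIV" for d
  proof -
    have "bij (\<lambda>\<mu>. \<mu> + d)"
      by (rule bij_plus_right)
    then show ?thesis
      using summable_on_reindex_bij_betw[of "\<lambda>\<mu>. \<mu> + d" UNIV UNIV "\<lambda>\<mu>. (cmod (f \<mu>))\<^sup>2"] assms
      by (simp add: ell2_def)
  qed
  have sm: "(\<lambda>\<mu>. ?C * (\<Sum>d\<in>?K. (cmod (f (\<mu> + d)))\<^sup>2)) summable_on UNIV"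
    by (intro summable_on_cmult_right summable_on_finite_sum shift)
  have "(cmod (adjacency_op u f \<mu>))\<^sup>2 \<le> ?C * (\<Sum>d\<in>?K. (cmod (f (\<mu> + d)))\<^sup>2)" for \<mu>
  proof -
    have "cmod (adjacency_op u f \<mu>) \<le> (\<Sum>d\<in>?K. real (?c d) * cmod (f (\<mu> + d)))"
      unfolding adjacency_op_eq_sum by (rule order_trans[OF norm_sum]) (simp add: norm_mult)
    then have "(cmod (adjacency_op u f \<mu>))\<^sup>2 \<le> (\<Sum>d\<in>?K. real (?c d) * cmod (f (\<mu> + d)))\<^sup>2"
      by (simp add: power_mono)
    also have "\<dots> \<le> ?C * (\<Sum>d\<in>?K. (cmod (f (\<mu> + d)))\<^sup>2)"
      by (rule Cauchy_Schwarz_ineq_sum)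
    finally show ?thesis .
  qed
  then have "(\<lambda>\<mu>. (cmod (adjacency_op u f \<mu>))\<^sup>2) summable_on UNIV"
    by (intro summable_on_comparison_test[OF sm]) auto
  then show ?thesis
    by (simp add: ell2_def)
qed

text \<open>
  The characters are real on the torus (\<open>character_real_on_torus\<close>), so taking real parts only
  changes the type.
\<close>

definition char_pair :: "irrep \<Rightarrow> irrep \<Rightarrow> complex \<times> complex \<Rightarrow> real \<times> real" where
  "char_pair u v = (\<lambda>(w1, w2). (Re (character u w1 w2), Re (character v w1 w2)))"

definition joint_dom :: "irrep \<Rightarrow> irrep \<Rightarrow> (real \<times> real) set" where
  "joint_dom u v = char_pair u v ` (sphere 0 1 \<times> sphere 0 1)"

text \<open>The case \<open>m = n = 0\<close> of the integrability condition makes \<open>M\<close> a finite measure.\<close>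

definition is_joint_spectral_measure :: "irrep \<Rightarrow> irrep \<Rightarrow> (real \<times> real) measure \<Rightarrow> bool" where
  "is_joint_spectral_measure u v M \<longleftrightarrow>
     sets M = sets (restrict_space borel (joint_dom u v)) \<and>
     (\<forall>m n. integrable M (\<lambda>(s, t). s ^ m * t ^ n) \<and>
       complex_of_real (\<integral>(s, t). s ^ m * t ^ n \<partial>M) =
         ell2_inner ((adjacency_op u ^^ m) ((adjacency_op v ^^ n) (ell2_basis (0, 0))))
           (ell2_basis (0, 0)))"

definition joint_spectral_measure :: "irrep \<Rightarrow> irrep \<Rightarrow> (real \<times> real) measure" where
  "joint_spectral_measure u v = (THE M. is_joint_spectral_measure u v M)"

definition torus_point :: "real^2 \<Rightarrow> complex \<times> complex" where
  "torus_point \<theta> = (cis (2 * pi * \<theta>$1), cis (2 * pi * \<theta>$2))"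

definition char_jacobian :: "irrep \<Rightarrow> irrep \<Rightarrow> real^2 \<Rightarrow> real" where
  "char_jacobian u v \<theta> =
     det (jacobian
       (\<lambda>\<theta>. vector [fst (char_pair u v (torus_point \<theta>)), snd (char_pair u v (torus_point \<theta>))] :: real^2)
       (at \<theta>))"

text \<open>
  \<open>|J|\<close> as a function on \<^term>\<open>joint_dom u v\<close>: the common value of \<open>|J|\<close> at all \<open>\<theta>\<close> lying over the
  given point. That it is well defined for the two pairs under consideration, with the explicit
  value expected, is shown in \<open>abs_jacobian_xy\<close> and \<open>abs_jacobian_yz\<close>. It vanishes on a null set,
  where the convention \<open>inverse 0 = 0\<close> in a density \<open>c |J|\<^sup>-\<^sup>1\<close> is harmless.
\<close>

definition abs_jacobian :: "irrep \<Rightarrow> irrep \<Rightarrow> real \<times> real \<Rightarrow> real" where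
  "abs_jacobian u v p =
     (THE j. \<exists>\<theta>. char_pair u v (torus_point \<theta>) = p \<and> j = \<bar>char_jacobian u v \<theta>\<bar>)"

lemma joint_dom_eq: "joint_dom u v = range (\<lambda>\<theta>. char_pair u v (torus_point \<theta>))"
proof -
  have "range torus_point = sphere 0 1 \<times> sphere 0 1"
  proof (intro equalityI subsetI)
    fix w :: "complex \<times> complex" assume "w \<in> sphere 0 1 \<times> sphere 0 1"
    then have n: "norm (fst w) = 1" "norm (snd w) = 1"
      by auto
    obtain a where a: "fst w = cis a"
      using n(1) by (metis cis_Arg norm_zero sgn_eq zero_neq_one div_by_1 of_real_1)
    obtain b where b: "snd w = cis b"
      using n(2) by (metis cis_Arg norm_zero sgn_eq zero_neq_one div_by_1 of_real_1)
    have "w = torus_point (vector [a / (2 * pi), b / (2 * pi)])"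
      using a b by (simp add: torus_point_def prod_eq_iff)
    then show "w \<in> range torus_point"
      by blast
  qed (auto simp: torus_point_def)
  then show ?thesis
    by (metis joint_dom_def image_image)
qed

lemma char_pair_xy:
  "char_pair Rho_x Rho_y (torus_point \<theta>) =
     (2 * cos (2 * pi * \<theta>$1) + 2 * cos (2 * pi * \<theta>$2),
      1 + 4 * cos (2 * pi * \<theta>$1) * cos (2 * pi * \<theta>$2))"
  by (simp add: char_pair_def torus_point_def character_Rho_x character_Rho_y)

lemma char_pair_yz:
  "char_pair Rho_y Rho_z (torus_point \<theta>) =
     (1 + 4 * cos (2 * pi * \<theta>$1) * cos (2 * pi * \<theta>$2),
      4 * (cos (2 * pi * \<theta>$1))\<^sup>2 + 4 * (cos (2 * pi * \<theta>$2))\<^sup>2 - 2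
      + 4 * cos (2 * pi * \<theta>$1) * cos (2 * pi * \<theta>$2))"
proof -
  have r: "(cis a)\<^sup>2 = Complex (2 * (cos a)\<^sup>2 - 1) (sin (2 * a))"
    "inverse ((cis a)\<^sup>2) = Complex (2 * (cos a)\<^sup>2 - 1) (- sin (2 * a))" for a
    unfolding cos_double_cos[symmetric]
    by (simp_all add: complex_eq_iff power_inverse[symmetric] power2_eq_square cis_mult)
  show ?thesis
    unfolding char_pair_def torus_point_def character_Rho_y character_Rho_z prod.case r(2)
    unfolding r(1) by simp
qed

lemma has_derivative_cos_nth:
  "((\<lambda>\<theta>::real^2. cos (2 * pi * \<theta>$k)) has_derivative
      (\<lambda>h. - 2 * pi * sin (2 * pi * \<theta>$k) * h$k)) (at \<theta>)"
proof -
  have "((\<lambda>\<theta>::real^2. 2 * pi * \<theta>$k) has_derivative (\<lambda>h. 2 * pi * h$k)) (at \<theta>)"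
    by (intro has_derivative_mult_right bounded_linear_imp_has_derivative bounded_linear_vec_nth)
  from has_derivative_cos[OF this] show ?thesis
    by (rule has_derivative_eq_rhs) (simp add: fun_eq_iff)
qed

lemma det_jacobian_2:
  fixes F G :: "real^2 \<Rightarrow> real"
  assumes F: "(F has_derivative (\<lambda>h. F1 * h$1 + F2 * h$2)) (at \<theta>)"
    and G: "(G has_derivative (\<lambda>h. G1 * h$1 + G2 * h$2)) (at \<theta>)"
  shows "det (jacobian (\<lambda>\<theta>. vector [F \<theta>, G \<theta>] :: real^2) (at \<theta>)) = F1 * G2 - F2 * G1"
proof -
  let ?f = "\<lambda>\<theta>. vector [F \<theta>, G \<theta>] :: real^2"
  let ?M = "vector [vector [F1, F2], vector [G1, G2]] :: real^2^2"
  have "((\<lambda>\<theta>. axis 1 (F \<theta>) + axis 2 (G \<theta>) :: real^2) has_derivative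
      (\<lambda>h. axis 1 (F1 * h$1 + F2 * h$2) + axis 2 (G1 * h$1 + G2 * h$2))) (at \<theta>)"
  proof -
    have "bounded_linear (axis k :: real \<Rightarrow> real^2)" for k
      by (intro linear_conv_bounded_linear[THEN iffD1]) (auto intro!: linearI simp: axis_def vec_eq_iff)
    from has_derivative_add[OF bounded_linear.has_derivative[OF this F]
        bounded_linear.has_derivative[OF this G]]
    show ?thesis .
  qed
  also have "(\<lambda>\<theta>. axis 1 (F \<theta>) + axis 2 (G \<theta>) :: real^2) = ?f"
    by (auto simp: fun_eq_iff vec_eq_iff forall_2 axis_def)
  also have "(\<lambda>h::real^2. axis 1 (F1 * h$1 + F2 * h$2) + axis 2 (G1 * h$1 + G2 * h$2)) = (*v) ?M"
    by (auto simp: fun_eq_iff vec_eq_iff forall_2 axis_def matrix_vector_mult_def sum_2)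
  finally have "frechet_derivative ?f (at \<theta>) = (*v) ?M"
    by (rule frechet_derivative_at[symmetric])
  then have "jacobian ?f (at \<theta>) = ?M"
    by (simp add: jacobian_def)
  then show ?thesis
    by (simp add: det_2)
qed

lemma char_jacobian_xy:
  "char_jacobian Rho_x Rho_y \<theta> =
     4 * pi\<^sup>2 * (8 * sin (2 * pi * \<theta>$1) * sin (2 * pi * \<theta>$2)
       * (cos (2 * pi * \<theta>$1) - cos (2 * pi * \<theta>$2)))"
proof -
  define S1 S2 C1 C2 where d: "S1 = sin (2 * pi * \<theta>$1)" "S2 = sin (2 * pi * \<theta>$2)"
    "C1 = cos (2 * pi * \<theta>$1)" "C2 = cos (2 * pi * \<theta>$2)"
  have "char_jacobian Rho_x Rho_y \<theta> =
      (-4 * pi * S1) * (-8 * pi * C1 * S2) - (-4 * pi * S2) * (-8 * pi * S1 * C2)"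
    unfolding char_jacobian_def char_pair_xy fst_conv snd_conv
  proof (rule det_jacobian_2)
    note c = has_derivative_cos_nth[of 1 \<theta>] has_derivative_cos_nth[of 2 \<theta>]
    show "((\<lambda>\<theta>. 2 * cos (2 * pi * \<theta>$1) + 2 * cos (2 * pi * \<theta>$2)) has_derivative
        (\<lambda>h. (-4 * pi * S1) * h$1 + (-4 * pi * S2) * h$2)) (at \<theta>)"
      by (rule has_derivative_eq_rhs, rule has_derivative_add[OF
            has_derivative_mult_right[OF c(1)] has_derivative_mult_right[OF c(2)]])
        (simp add: fun_eq_iff d)
    show "((\<lambda>\<theta>. 1 + 4 * cos (2 * pi * \<theta>$1) * cos (2 * pi * \<theta>$2)) has_derivative
        (\<lambda>h. (-8 * pi * S1 * C2) * h$1 + (-8 * pi * C1 * S2) * h$2)) (at \<theta>)"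
      by (rule has_derivative_eq_rhs, rule has_derivative_add[OF has_derivative_const
            has_derivative_mult[OF has_derivative_mult_right[OF c(1)] c(2)]])
        (simp add: fun_eq_iff d algebra_simps)
  qed
  then show ?thesis
    unfolding d[symmetric] by (simp add: power2_eq_square algebra_simps)
qed

lemma char_jacobian_yz:
  "char_jacobian Rho_y Rho_z \<theta> =
     4 * pi\<^sup>2 * (32 * sin (2 * pi * \<theta>$1) * sin (2 * pi * \<theta>$2)
       * ((cos (2 * pi * \<theta>$2))\<^sup>2 - (cos (2 * pi * \<theta>$1))\<^sup>2))"
proof -
  define S1 S2 C1 C2 where d: "S1 = sin (2 * pi * \<theta>$1)" "S2 = sin (2 * pi * \<theta>$2)"
    "C1 = cos (2 * pi * \<theta>$1)" "C2 = cos (2 * pi * \<theta>$2)"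
  have "char_jacobian Rho_y Rho_z \<theta> =
      (-8 * pi * S1 * C2) * (-16 * pi * C2 * S2 - 8 * pi * C1 * S2)
      - (-8 * pi * C1 * S2) * (-16 * pi * C1 * S1 - 8 * pi * S1 * C2)"
    unfolding char_jacobian_def char_pair_yz fst_conv snd_conv
  proof (rule det_jacobian_2)
    note c = has_derivative_cos_nth[of 1 \<theta>] has_derivative_cos_nth[of 2 \<theta>]
    note m = has_derivative_mult[OF has_derivative_mult_right[OF c(1)] c(2)]
    show "((\<lambda>\<theta>. 1 + 4 * cos (2 * pi * \<theta>$1) * cos (2 * pi * \<theta>$2)) has_derivative
        (\<lambda>h. (-8 * pi * S1 * C2) * h$1 + (-8 * pi * C1 * S2) * h$2)) (at \<theta>)"
      by (rule has_derivative_eq_rhs, rule has_derivative_add[OF has_derivative_const m])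
        (simp add: fun_eq_iff d algebra_simps)
    show "((\<lambda>\<theta>. 4 * (cos (2 * pi * \<theta>$1))\<^sup>2 + 4 * (cos (2 * pi * \<theta>$2))\<^sup>2 - 2
          + 4 * cos (2 * pi * \<theta>$1) * cos (2 * pi * \<theta>$2)) has_derivative
        (\<lambda>h. (-16 * pi * C1 * S1 - 8 * pi * S1 * C2) * h$1
          + (-16 * pi * C2 * S2 - 8 * pi * C1 * S2) * h$2)) (at \<theta>)"
      by (rule has_derivative_eq_rhs, rule has_derivative_add[OF has_derivative_diff[OF
              has_derivative_add[OF has_derivative_mult_right[OF has_derivative_power[OF c(1)]]
                has_derivative_mult_right[OF has_derivative_power[OF c(2)]]]
              has_derivative_const] m])
        (simp add: fun_eq_iff d algebra_simps)
  qed
  then show ?thesis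
    unfolding d[symmetric] by (simp add: power2_eq_square algebra_simps)
qed

lemma abs_jacobian_eqI:
  assumes "p \<in> joint_dom u v"
    and "\<And>\<theta>. char_pair u v (torus_point \<theta>) = p \<Longrightarrow> \<bar>char_jacobian u v \<theta>\<bar> = j"
  shows "abs_jacobian u v p = j"
  unfolding abs_jacobian_def using assms by (intro the_equality) (auto simp: joint_dom_eq)

lemma abs_jacobian_xy:
  assumes "(x, y) \<in> joint_dom Rho_x Rho_y"
  shows "abs_jacobian Rho_x Rho_y (x, y) =
     4 * pi\<^sup>2 * sqrt ((y + 2 * x + 3) * (y - 2 * x + 3) * (x\<^sup>2 - 4 * y + 4))"
  using assms
proof (rule abs_jacobian_eqI)
  fix \<theta> :: "real^2" assume p: "char_pair Rho_x Rho_y (torus_point \<theta>) = (x, y)"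
  define S1 S2 C1 C2 where d: "S1 = sin (2 * pi * \<theta>$1)" "S2 = sin (2 * pi * \<theta>$2)"
    "C1 = cos (2 * pi * \<theta>$1)" "C2 = cos (2 * pi * \<theta>$2)"
  have S: "S1\<^sup>2 = 1 - C1\<^sup>2" "S2\<^sup>2 = 1 - C2\<^sup>2"
    by (simp_all add: d sin_squared_eq)
  have xy: "x = 2 * C1 + 2 * C2" "y = 1 + 4 * C1 * C2"
    using p by (auto simp: char_pair_xy d)
  have "(8 * S1 * S2 * (C1 - C2))\<^sup>2 = 64 * S1\<^sup>2 * S2\<^sup>2 * (C1 - C2)\<^sup>2"
    by (simp add: power_mult_distrib)
  also have "\<dots> = (y + 2 * x + 3) * (y - 2 * x + 3) * (x\<^sup>2 - 4 * y + 4)"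
    unfolding S xy by algebra
  finally have "sqrt ((y + 2 * x + 3) * (y - 2 * x + 3) * (x\<^sup>2 - 4 * y + 4)) =
      \<bar>8 * S1 * S2 * (C1 - C2)\<bar>"
    by (metis real_sqrt_abs)
  then show "\<bar>char_jacobian Rho_x Rho_y \<theta>\<bar> =
      4 * pi\<^sup>2 * sqrt ((y + 2 * x + 3) * (y - 2 * x + 3) * (x\<^sup>2 - 4 * y + 4))"
    by (simp add: char_jacobian_xy d abs_mult)
qed

lemma abs_jacobian_yz:
  assumes "(y, z) \<in> joint_dom Rho_y Rho_z"
  shows "abs_jacobian Rho_y Rho_z (y, z) =
     8 * pi\<^sup>2 * sqrt ((z - 3 * y + 5) * (z + y + 1) * (y\<^sup>2 + 2 * y + 5 - 4 * z))"
  using assms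
proof (rule abs_jacobian_eqI)
  fix \<theta> :: "real^2" assume p: "char_pair Rho_y Rho_z (torus_point \<theta>) = (y, z)"
  define S1 S2 C1 C2 where d: "S1 = sin (2 * pi * \<theta>$1)" "S2 = sin (2 * pi * \<theta>$2)"
    "C1 = cos (2 * pi * \<theta>$1)" "C2 = cos (2 * pi * \<theta>$2)"
  have S: "S1\<^sup>2 = 1 - C1\<^sup>2" "S2\<^sup>2 = 1 - C2\<^sup>2"
    by (simp_all add: d sin_squared_eq)
  have yz: "y = 1 + 4 * C1 * C2" "z = 4 * C1\<^sup>2 + 4 * C2\<^sup>2 - 2 + 4 * C1 * C2"
    using p by (auto simp: char_pair_yz d)
  have "(16 * S1 * S2 * (C2\<^sup>2 - C1\<^sup>2))\<^sup>2 = 256 * S1\<^sup>2 * S2\<^sup>2 * (C2\<^sup>2 - C1\<^sup>2)\<^sup>2"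
    by (simp add: power_mult_distrib)
  also have "\<dots> = (z - 3 * y + 5) * (z + y + 1) * (y\<^sup>2 + 2 * y + 5 - 4 * z)"
    unfolding S yz by algebra
  finally have "sqrt ((z - 3 * y + 5) * (z + y + 1) * (y\<^sup>2 + 2 * y + 5 - 4 * z)) =
      \<bar>16 * S1 * S2 * (C2\<^sup>2 - C1\<^sup>2)\<bar>"
    by (metis real_sqrt_abs)
  then show "\<bar>char_jacobian Rho_y Rho_z \<theta>\<bar> =
      8 * pi\<^sup>2 * sqrt ((z - 3 * y + 5) * (z + y + 1) * (y\<^sup>2 + 2 * y + 5 - 4 * z))"
    by (simp add: char_jacobian_yz d abs_mult)
qed

end

theory Submission
  imports Defs
begin

text \<open>
  By Fourier analysis, the moments of the pair of graphs are integrals over the torus: acting with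
  the adjacency operator of \<open>\<rho>\<^sub>u\<close> on the Fourier coefficients of a function \<open>g\<close> gives
  those of \<open>\<chi>\<^sub>u g\<close>, and the basis vector at the origin is the sequence of Fourier coefficients of the
  constant \<open>1\<close>. A joint spectral measure is therefore a measure with the same moments as the image of the
  uniform measure on the torus under \<open>\<Phi> = (\<chi>\<^sub>u, \<chi>\<^sub>v)\<close>
  (\<open>spectral_moment_eq_integral_torus\<close>). As the image of \<open>\<Phi>\<close> is compact, Stone-Weierstrass shows
  that the moments determine the measure (\<open>finite_measures_eqI_moments\<close>), so it is
  enough to check the moments of the claimed density.

  Both coordinates of \<open>\<Phi>\<close> are symmetric functions of \<open>cos (2\<pi>\<theta>\<^sub>1)\<close> and \<open>cos (2\<pi>\<theta>\<^sub>2)\<close>. They are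
  invariant under the reflections in \<open>\<theta>\<^sub>1 = 1/2\<close>, \<open>\<theta>\<^sub>2 = 1/2\<close> and
  \<open>\<theta>\<^sub>1 = \<theta>\<^sub>2\<close>. Folding the unit square along these lines, one after the other, reduces an integral over
  the torus to \<open>8\<close> times the integral over the triangle \<open>0 < \<theta>\<^sub>1 < \<theta>\<^sub>2 < 1/2\<close>
  (\<open>integral_unit_square_eq_8_chamber\<close>), a chamber for the Weyl group of order \<open>8\<close>. For the
  pair \<open>(y, z)\<close>, negating both cosines is a further symmetry, realised by the reflection in
  \<open>\<theta>\<^sub>1 + \<theta>\<^sub>2 = 1/2\<close>; hence the factor \<open>16\<close>.

  On the open chamber the Jacobian of \<open>\<Phi>\<close> has no zeros and \<open>\<Phi>\<close> is injective, because a pair of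
  cosines in known order can be recovered from its sum and product. The image of the chamber consists
  exactly of the points of the domain where \<open>|J|\<close> does not vanish. So the change of variables
  formula turns the integral over the chamber into an integral with density \<open>|J|\<^sup>-\<^sup>1\<close> over the
  domain; the remaining points of the domain contribute nothing, as \<open>inverse 0 = 0\<close> there. This last part is
  \<open>is_joint_spectral_measure_density\<close>.
\<close>

section \<open>Measures on a compact subset of the plane are determined by their moments\<close>

inductive bivariate_polynomial :: "(real \<times> real \<Rightarrow> real) \<Rightarrow> bool" where
  monomial: "bivariate_polynomial (\<lambda>(s, t). c * (s ^ m * t ^ n))"
| add: "bivariate_polynomial f \<Longrightarrow> bivariate_polynomial g \<Longrightarrow> bivariate_polynomial (\<lambda>p. f p + g p)"

lemma bivariate_polynomial_mult_monomial:
  assumes "bivariate_polynomial f"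
  shows "bivariate_polynomial (\<lambda>p. c * (fst p ^ m * snd p ^ n) * f p)"
  using assms
proof induction
  case (monomial c' m' n')
  have "(\<lambda>p. c * (fst p ^ m * snd p ^ n) * (case p of (s, t) \<Rightarrow> c' * (s ^ m' * t ^ n'))) =
      (\<lambda>(s, t). (c * c') * (s ^ (m + m') * t ^ (n + n')))"
    by (auto simp: fun_eq_iff power_add)
  then show ?case
    by (simp only: bivariate_polynomial.monomial)
next
  case (add f g)
  then show ?case
    by (simp add: distrib_left bivariate_polynomial.add)
qed

text \<open>
  Proving that multiplication by \<open>f\<close> preserves bivariate polynomials, instead of the claim itself,
  makes the case of a product trivial.
\<close>

lemma bivariate_polynomial_if_real_polynomial_function:
  assumes "real_polynomial_function f"
  shows "bivariate_polynomial f"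
proof -
  have "bivariate_polynomial (\<lambda>p. f p * g p)" if "bivariate_polynomial g" for g
    using assms that
  proof (induction arbitrary: g)
    case (linear f)
    have f: "f p = f (1, 0) * fst p + f (0, 1) * snd p" for p
    proof -
      have "f (fst p *\<^sub>R (1, 0) + snd p *\<^sub>R (0, 1)) = fst p *\<^sub>R f (1, 0) + snd p *\<^sub>R f (0, 1)"
        using linear(1) by (simp only: linear_simps)
      then show ?thesis by (simp add: mult.commute)
    qed
    show ?case
      using bivariate_polynomial.add[OF
          bivariate_polynomial_mult_monomial[OF linear(2), of "f (1, 0)" 1 0]
          bivariate_polynomial_mult_monomial[OF linear(2), of "f (0, 1)" 0 1]]
      by (subst f) (simp add: distrib_right)
  next
    case (const c)
    then show ?case
      using bivariate_polynomial_mult_monomial[of g c 0 0] by simp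
  next
    case (add f1 f2)
    then show ?case
      by (simp add: distrib_right bivariate_polynomial.add)
  next
    case (mult f1 f2)
    then show ?case
      by (simp add: mult.assoc)
  qed
  from this[of "\<lambda>_. 1"] show ?thesis
    using bivariate_polynomial.monomial[of 1 0 0] by (simp add: case_prod_unfold)
qed

text \<open>
  Equal moments give equal integrals of polynomials, hence of continuous functions by
  Stone-Weierstrass, hence of indicators of closed sets by dominated convergence; the closed sets are
  an intersection-stable generator of the Borel sets.
\<close>

lemma finite_measures_eqI_moments:
  fixes D :: "(real \<times> real) set"
  assumes D: "compact D"
    and sets_M: "sets M = sets (restrict_space borel D)"
    and sets_N: "sets N = sets (restrict_space borel D)"
    and int_M: "\<And>m n. integrable M (\<lambda>(s, t). s ^ m * t ^ n)"
    and int_N: "\<And>m n. integrable N (\<lambda>(s, t). s ^ m * t ^ n)"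
    and eq: "\<And>m n. (\<integral>(s, t). s ^ m * t ^ n \<partial>M) = (\<integral>(s, t). s ^ m * t ^ n \<partial>N)"
  shows "M = N"
proof -
  have Db: "D \<in> sets borel"
    using D by (simp add: compact_imp_closed)
  have sp: "space M = D" "space N = D"
    using sets_eq_imp_space_eq[OF sets_M] sets_eq_imp_space_eq[OF sets_N]
    by (simp_all add: space_restrict_space)
  have "integrable M (\<lambda>_. 1 :: real)" "integrable N (\<lambda>_. 1 :: real)"
    using int_M[of 0 0] int_N[of 0 0] by (simp_all add: case_prod_unfold)
  from this[THEN integrableD(2)] have "emeasure M (space M) \<noteq> \<infinity>" "emeasure N (space N) \<noteq> \<infinity>"
    by simp_all
  then interpret M: finite_measure M + N: finite_measure N
    by (simp_all add: finite_measureI)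
  have cont_meas: "f \<in> borel_measurable M" "f \<in> borel_measurable N"
    if "continuous_on D f" for f :: "real \<times> real \<Rightarrow> real"
    using borel_measurable_continuous_on_restrict[OF that] measurable_cong_sets[OF sets_M refl]
      measurable_cong_sets[OF sets_N refl] by auto
  have cont_int: "integrable M f" "integrable N f"
    if "continuous_on D f" for f :: "real \<times> real \<Rightarrow> real"
  proof -
    have "bounded (f ` D)"
      using that D compact_continuous_image compact_imp_bounded by blast
    then obtain B where "\<And>x. x \<in> D \<Longrightarrow> norm (f x) \<le> B"
      by (auto simp: bounded_iff)
    then show "integrable M f" "integrable N f"
      using cont_meas[OF that] sp
      by (auto intro!: M.integrable_const_bound[of _ B] N.integrable_const_bound[of _ B] AE_I2)
  qed
  have poly: "integrable M f \<and> integrable N f \<and> (\<integral>p. f p \<partial>M) = (\<integral>p. f p \<partial>N)"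
    if "bivariate_polynomial f" for f
    using that
  proof induction
    case (monomial c m n)
    show ?case
      using int_M[of m n] int_N[of m n] eq[of m n] by (simp add: case_prod_unfold)
  qed simp
  have cont: "(\<integral>p. f p \<partial>M) = (\<integral>p. f p \<partial>N)" if f: "continuous_on D f"
    for f :: "real \<times> real \<Rightarrow> real"
  proof (rule ccontr)
    assume ne: "(\<integral>p. f p \<partial>M) \<noteq> (\<integral>p. f p \<partial>N)"
    \<comment> \<open>The summand 1 only serves to make the divisor of the next definition positive.\<close>
    define C where "C = measure M D + measure N D + 1"
    define e where "e = \<bar>(\<integral>p. f p \<partial>M) - (\<integral>p. f p \<partial>N)\<bar> / C"
    have C: "C > 0"
      unfolding C_def by (intro add_nonneg_pos add_nonneg_nonneg) auto
    then have e: "e > 0"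
      using ne by (simp add: e_def)
    obtain g where g: "real_polynomial_function g" "\<And>x. x \<in> D \<Longrightarrow> \<bar>f x - g x\<bar> < e"
      using Stone_Weierstrass_real_polynomial_function[OF D f e] by blast
    note pg = poly[OF bivariate_polynomial_if_real_polynomial_function[OF g(1)]]
    have "\<bar>(\<integral>p. f p \<partial>M) - (\<integral>p. g p \<partial>M)\<bar> \<le> e * measure M D"
    proof -
      have "\<bar>\<integral>p. f p - g p \<partial>M\<bar> \<le> (\<integral>p. e \<partial>M)"
        using pg cont_int[OF f] g(2) sp
        by (intro order_trans[OF integral_abs_bound] integral_mono) (auto intro: less_imp_le)
      then show ?thesis
        using pg cont_int[OF f] sp by (simp add: mult.commute)
    qed
    moreover have "\<bar>(\<integral>p. f p \<partial>N) - (\<integral>p. g p \<partial>N)\<bar> \<le> e * measure N D"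
    proof -
      have "\<bar>\<integral>p. f p - g p \<partial>N\<bar> \<le> (\<integral>p. e \<partial>N)"
        using pg cont_int[OF f] g(2) sp
        by (intro order_trans[OF integral_abs_bound] integral_mono) (auto intro: less_imp_le)
      then show ?thesis
        using pg cont_int[OF f] sp by (simp add: mult.commute)
    qed
    ultimately have "\<bar>(\<integral>p. f p \<partial>M) - (\<integral>p. f p \<partial>N)\<bar> \<le> e * (measure M D + measure N D)"
      using pg by (simp add: distrib_left)
    also have "\<dots> < e * C"
      using e by (simp add: C_def)
    also have "\<dots> = \<bar>(\<integral>p. f p \<partial>M) - (\<integral>p. f p \<partial>N)\<bar>"
      using C by (simp add: e_def)
    finally show False by simp
  qed
  have sets_D: "sets M = (\<inter>) D ` sets borel" "sets N = (\<inter>) D ` sets borel"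
    by (simp_all add: sets_M sets_N sets_restrict_space)
  have closed: "measure M (D \<inter> K) = measure N (D \<inter> K)" if K: "closed K" for K
  proof (cases "K = {}")
    case False
    \<comment> \<open>Continuous functions that decrease to the indicator of the closed set.\<close>
    define h where "h k p = max 0 (1 - real k * infdist p K)" for k :: nat and p :: "real \<times> real"
    have h_cont: "continuous_on D (h k)" for k
      unfolding h_def by (intro continuous_intros)
    have lim: "(\<lambda>k. h k p) \<longlonglongrightarrow> indicator K p" for p
    proof (cases "p \<in> K")
      case True
      then show ?thesis by (simp add: h_def)
    next
      case p: False
      then have d: "infdist p K > 0"
        using K False infdist_pos_not_in_closed by blast
      obtain k0 where k0: "real k0 * infdist p K > 1"
        using d reals_Archimedean3 by blast
      have "h k p = 0" if "k \<ge> k0" for k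
      proof -
        have "real k0 * infdist p K \<le> real k * infdist p K"
          using that d by (intro mult_right_mono) auto
        then show ?thesis using k0 by (simp add: h_def)
      qed
      then have "\<forall>\<^sub>F k in sequentially. h k p = 0"
        by (auto simp: eventually_sequentially)
      then show ?thesis
        using p by (simp add: tendsto_eventually)
    qed
    have bd: "norm (h k p) \<le> 1" for k p
      by (auto simp: h_def infdist_nonneg)
    have ind: "(\<integral>p. indicator K p \<partial>M) = measure M (D \<inter> K)"
        "(\<integral>p. indicator K p \<partial>N) = measure N (D \<inter> K)"
      by (simp_all add: sp Int_commute)
    have ind_meas: "(indicator K :: _ \<Rightarrow> real) \<in> borel_measurable M" "(indicator K :: _ \<Rightarrow> real) \<in> borel_measurable N"
      using measurable_restrict_space1[of "indicator K :: _ \<Rightarrow> real" borel borel D] K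
        measurable_cong_sets[OF sets_M refl] measurable_cong_sets[OF sets_N refl] by auto
    have "(\<lambda>k. \<integral>p. h k p \<partial>M) \<longlonglongrightarrow> (\<integral>p. indicator K p \<partial>M)"
      by (rule integral_dominated_convergence[where w = "\<lambda>_. 1"])
        (use cont_meas[OF h_cont] ind_meas lim bd in auto)
    moreover have "(\<lambda>k. \<integral>p. h k p \<partial>N) \<longlonglongrightarrow> (\<integral>p. indicator K p \<partial>N)"
      by (rule integral_dominated_convergence[where w = "\<lambda>_. 1"])
        (use cont_meas[OF h_cont] ind_meas lim bd in auto)
    ultimately show ?thesis
      unfolding ind using cont[OF h_cont] LIMSEQ_unique by auto
  qed simp
  let ?E = "(\<inter>) D ` Collect closed"
  have gen: "(\<inter>) D ` sets borel = sigma_sets D ?E"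
  proof -
    have "sets borel = sigma_sets UNIV (Collect closed :: (real \<times> real) set set)"
      by (simp add: borel_eq_closed)
    then show ?thesis
      using sigma_sets_Int[of D UNIV "Collect closed"] Db by simp
  qed
  show "M = N"
  proof (rule measure_eqI_generator_eq[where E = ?E and \<Omega> = D and A = "\<lambda>_. D"])
    show "Int_stable ?E"
    proof (rule Int_stableI)
      fix X Y assume "X \<in> ?E" "Y \<in> ?E"
      then obtain K L where "closed K" "closed L" "X = D \<inter> K" "Y = D \<inter> L"
        by blast
      then show "X \<inter> Y \<in> ?E"
        by (intro image_eqI[where x = "K \<inter> L"]) auto
    qed
    fix X assume "X \<in> ?E"
    then show "emeasure M X = emeasure N X"
      using closed by (auto simp: M.emeasure_eq_measure N.emeasure_eq_measure)
  qed (use gen sets_D M.emeasure_finite in \<open>auto intro: image_eqI[where x = UNIV]\<close>)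
qed

section \<open>Change of variables and folding along a hyperplane\<close>

text \<open>
  The scalar version of \<open>has_absolute_integral_change_of_variables\<close>, obtained by reading a real
  number as a vector of length one.
\<close>

lemma has_absolute_integral_change_of_variables_scalar:
  fixes f :: "real^'m::{finite,wellorder} \<Rightarrow> real" and g :: "real^'m::_ \<Rightarrow> real^'m::_"
  assumes S: "S \<in> sets lebesgue"
    and der_g: "\<And>x. x \<in> S \<Longrightarrow> (g has_derivative g' x) (at x within S)"
    and inj: "inj_on g S"
    and f: "(\<lambda>x. \<bar>det (matrix (g' x))\<bar> * f (g x)) absolutely_integrable_on S"
  shows "f absolutely_integrable_on g ` S"
    and "integral (g ` S) f = integral S (\<lambda>x. \<bar>det (matrix (g' x))\<bar> * f (g x))"
proof -
  have "(f absolutely_integrable_on g ` S) \<and>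
    integral (g ` S) f = integral S (\<lambda>x. \<bar>det (matrix (g' x))\<bar> * f (g x))"
    using has_absolute_integral_change_of_variables[OF S der_g inj, of "\<lambda>x. vec (f x) :: real^1"
        "vec (integral S (\<lambda>x. \<bar>det (matrix (g' x))\<bar> * f (g x)))"] f
    by (simp add: absolutely_integrable_on_1_iff integral_on_1_eq vec_eq_iff)
  then show "f absolutely_integrable_on g ` S"
    and "integral (g ` S) f = integral S (\<lambda>x. \<bar>det (matrix (g' x))\<bar> * f (g x))"
    by auto
qed

text \<open>
  The reflection in the hyperplane of all \<open>x\<close> with \<open>v \<bullet> x = r\<close>. For \<open>r = 0\<close> it is linear, and it is
  the linear part of the reflections with other values of \<open>r\<close>.
\<close>

definition affine_reflection :: "'a::real_inner \<Rightarrow> real \<Rightarrow> 'a \<Rightarrow> 'a" where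
  "affine_reflection v r x = x - (2 * (v \<bullet> x - r) / (v \<bullet> v)) *\<^sub>R v"

lemma inner_affine_reflection:
  assumes "v \<noteq> 0"
  shows "v \<bullet> affine_reflection v r x = 2 * r - v \<bullet> x"
  using assms by (simp add: affine_reflection_def inner_diff_right)

lemma affine_reflection_involution:
  assumes "v \<noteq> 0"
  shows "affine_reflection v r (affine_reflection v r x) = x"
proof -
  have "affine_reflection v r (affine_reflection v r x) =
      affine_reflection v r x - (2 * (r - v \<bullet> x) / (v \<bullet> v)) *\<^sub>R v"
    by (subst affine_reflection_def) (simp add: inner_affine_reflection[OF assms])
  also have "\<dots> = x"
    unfolding affine_reflection_def by (simp add: diff_diff_eq scaleR_left_distrib[symmetric] add_divide_distrib[symmetric])
  finally show ?thesis .
qed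

lemma orthogonal_transformation_reflection:
  assumes "v \<noteq> 0"
  shows "orthogonal_transformation (affine_reflection v 0)"
  unfolding orthogonal_transformation_def
proof (intro conjI allI)
  show "linear (affine_reflection v 0)"
    by (rule linearI) (simp_all add: affine_reflection_def inner_add_right algebra_simps add_divide_distrib)
  show "affine_reflection v 0 x \<bullet> affine_reflection v 0 y = x \<bullet> y" for x y
    using assms by (simp add: affine_reflection_def inner_diff_left inner_diff_right inner_commute)
qed

text \<open>
  The reflection exchanges the two sides of the hyperplane in \<open>A\<close> and its linear part has determinant
  \<open>-1\<close>, so both sides contribute equally; the hyperplane itself is negligible.
\<close>

lemma integral_fold_affine_reflection:
  fixes F :: "real^'m::{finite,wellorder} \<Rightarrow> real"
  assumes v: "v \<noteq> 0"
    and F: "F absolutely_integrable_on A" and A: "A \<in> sets lebesgue"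
    and A_inv: "\<And>x. x \<in> A \<Longrightarrow> affine_reflection v r x \<in> A"
    and F_inv: "\<And>x. F (affine_reflection v r x) = F x"
  shows "integral A F = 2 * integral {x \<in> A. v \<bullet> x < r} F"
proof -
  let ?s = "affine_reflection v r" and ?P = "{x \<in> A. v \<bullet> x < r}" and ?Q = "{x \<in> A. v \<bullet> x > r}"
  have P: "?P \<in> sets lebesgue" "?Q \<in> sets lebesgue"
    using sets.Int[OF A, of "{x. v \<bullet> x < r}"] sets.Int[OF A, of "{x. v \<bullet> x > r}"]
      open_halfspace_lt[of v r] open_halfspace_gt[of r v]
    by (auto simp: Int_def)
  have FP: "F absolutely_integrable_on ?P" "F absolutely_integrable_on ?Q"
    by (rule set_integrable_subset[OF F]; use P in auto)+
  have img: "?s ` ?P = ?Q"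
  proof (intro equalityI subsetI)
    fix y assume "y \<in> ?Q"
    then have "?s y \<in> ?P"
      using A_inv v by (auto simp: inner_affine_reflection)
    then show "y \<in> ?s ` ?P"
      by (intro image_eqI[where x = "?s y"]) (simp_all add: affine_reflection_involution[OF v])
  qed (use A_inv v in \<open>auto simp: inner_affine_reflection\<close>)
  have inj: "inj_on ?s ?P"
    by (rule inj_on_inverseI[of _ ?s]) (simp add: affine_reflection_involution[OF v])
  have bl: "bounded_linear (affine_reflection v 0)"
    using orthogonal_transformation_linear[OF orthogonal_transformation_reflection[OF v]]
    by (simp add: linear_conv_bounded_linear)
  have "?s = (\<lambda>x. affine_reflection v 0 x + (2 * r / (v \<bullet> v)) *\<^sub>R v)"
    by (auto simp: fun_eq_iff affine_reflection_def algebra_simps diff_divide_distrib)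
  then have der: "(?s has_derivative affine_reflection v 0) (at x within ?P)" for x
    using has_derivative_add_const[OF bounded_linear_imp_has_derivative[OF bl]] by metis
  have det: "\<bar>det (matrix (affine_reflection v 0))\<bar> = 1"
    using orthogonal_transformation_reflection[OF v] by simp
  have "integral ?Q F = integral ?P F"
    using has_absolute_integral_change_of_variables_scalar(2)[OF P(1) der inj, of F] FP
    by (simp add: det F_inv img)
  moreover have "integral A F = integral (?P \<union> ?Q) F"
  proof (rule integral_spike_set)
    have "negligible {x. v \<bullet> x = r}"
      using v by (simp add: negligible_hyperplane)
    then show "negligible {x \<in> A - (?P \<union> ?Q). F x \<noteq> 0}"
      by (rule negligible_subset) auto
    show "negligible {x \<in> ?P \<union> ?Q - A. F x \<noteq> 0}"
      by (rule negligible_subset[OF negligible_empty]) auto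
  qed
  moreover have "integral (?P \<union> ?Q) F = integral ?P F + integral ?Q F"
    using FP by (intro integral_Un set_lebesgue_integral_eq_integral negligible_subset[OF negligible_empty]) auto
  ultimately show ?thesis by simp
qed

text \<open>
  The change of variables theorem lives on \<open>real^2\<close>, whereas spectral measures are measures on
  pairs. The obvious bijection identifies boxes, and hence the Lebesgue measures.
\<close>

lemma lborel_pair_eq_distr_vec:
  "(lborel :: (real \<times> real) measure) = distr lborel borel (\<lambda>v :: real^2. (v $ 1, v $ 2))"
proof (rule lborel_eqI)
  fix l u :: "real \<times> real" assume lu: "\<And>b. b \<in> Basis \<Longrightarrow> l \<bullet> b \<le> u \<bullet> b"
  obtain l1 l2 u1 u2 where lu_eq: "l = (l1, l2)" "u = (u1, u2)"
    by (cases l, cases u)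
  let ?L = "vector [l1, l2] :: real^2" and ?U = "vector [u1, u2] :: real^2"
  have le: "l1 \<le> u1" "l2 \<le> u2"
    using lu[of "(1, 0)"] lu[of "(0, 1)"] by (auto simp: Basis_prod_def lu_eq)
  have vim: "(\<lambda>v :: real^2. (v $ 1, v $ 2)) -` box l u = box ?L ?U"
  proof -
    have "box l u = box l1 u1 \<times> box l2 u2"
      by (simp add: lu_eq box_prod)
    then show ?thesis
      by (auto simp: mem_box_cart forall_2)
  qed
  have Basis2: "(Basis :: (real^2) set) = {axis 1 1, axis 2 1}"
    by (auto simp: Basis_vec_def UNIV_2)
  have meas: "(\<lambda>v :: real^2. (v $ 1, v $ 2)) \<in> borel_measurable lborel"
    by (auto intro!: borel_measurable_continuous_onI continuous_intros)
  have "emeasure (distr lborel borel (\<lambda>v :: real^2. (v $ 1, v $ 2))) (box l u) = emeasure lborel (box ?L ?U)"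
    using meas by (subst emeasure_distr) (auto simp: vim)
  also have "\<dots> = (\<Prod>b\<in>Basis. (?U - ?L) \<bullet> b)"
    using le by (intro emeasure_lborel_box) (auto simp: Basis2 inner_axis)
  also have "(\<Prod>b\<in>Basis. (?U - ?L) \<bullet> b) = (\<Prod>b\<in>Basis. (u - l) \<bullet> b)"
    by (simp add: Basis2 axis_eq_axis inner_axis lu_eq Basis_prod_def)
  finally show "emeasure (distr lborel borel (\<lambda>v :: real^2. (v $ 1, v $ 2))) (box l u) = (\<Prod>b\<in>Basis. (u - l) \<bullet> b)" .
qed simp

lemma lborel_integral_pair_eq_vec:
  fixes f :: "real \<times> real \<Rightarrow> 'b::euclidean_space"
  assumes "f \<in> borel_measurable borel"
  shows "integrable lborel f \<longleftrightarrow> integrable lebesgue (\<lambda>v :: real^2. f (v$1, v$2))"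
    and "integral\<^sup>L lborel f = integral\<^sup>L lebesgue (\<lambda>v :: real^2. f (v$1, v$2))"
proof -
  have \<phi>: "(\<lambda>v :: real^2. (v$1, v$2)) \<in> borel_measurable lborel"
    by (auto intro!: borel_measurable_continuous_onI continuous_intros)
  have fv: "(\<lambda>v :: real^2. f (v$1, v$2)) \<in> borel_measurable lborel"
    using measurable_compose[OF \<phi> assms] by simp
  show "integrable lborel f \<longleftrightarrow> integrable lebesgue (\<lambda>v :: real^2. f (v$1, v$2))"
    unfolding lborel_pair_eq_distr_vec integrable_distr_eq[OF \<phi> assms]
    by (rule integrable_completion[OF fv, symmetric])
  show "integral\<^sup>L lborel f = integral\<^sup>L lebesgue (\<lambda>v :: real^2. f (v$1, v$2))"
    unfolding lborel_pair_eq_distr_vec integral_distr[OF \<phi> assms]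
    by (rule integral_completion[OF fv, symmetric])
qed

section \<open>Moments as integrals over the torus\<close>

text \<open>
  The function \<open>\<omega>\<^sub>1\<^sup>a \<omega>\<^sub>2\<^sup>b\<close> for \<open>d = (a, b)\<close>, as a function of the angles.
\<close>

definition torus_monomial :: "int \<times> int \<Rightarrow> real^2 \<Rightarrow> complex" where
  "torus_monomial d \<theta> = cis (2 * pi * (of_int (fst d) * \<theta>$1 + of_int (snd d) * \<theta>$2))"

lemma torus_monomial_add:
  "torus_monomial (d + e) \<theta> = torus_monomial d \<theta> * torus_monomial e \<theta>"
  by (simp add: torus_monomial_def cis_mult algebra_simps)

lemma continuous_on_torus_monomial [continuous_intros]:
  "continuous_on S (torus_monomial d)"
  unfolding torus_monomial_def by (intro continuous_intros)

lemma character_torus_point: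
  "case_prod (character u) (torus_point \<theta>) =
     (\<Sum>d\<in>Poly_Mapping.keys (weights u).
        of_nat (Poly_Mapping.lookup (weights u) d) * torus_monomial d \<theta>)"
proof -
  have "cis (2 * pi * \<theta>$1) powi fst d * cis (2 * pi * \<theta>$2) powi snd d = torus_monomial d \<theta>" for d
    by (simp add: torus_monomial_def cis_power_int cis_mult algebra_simps)
  then show ?thesis
    by (simp add: character_def laurent_eval_def torus_point_def case_prod_unfold mult.assoc)
qed

lemma continuous_on_character_torus_point [continuous_intros]:
  "continuous_on S (\<lambda>\<theta>. case_prod (character u) (torus_point \<theta>))"
  unfolding character_torus_point by (intro continuous_intros)

lemma cnj_character_torus_point:
  "cnj (case_prod (character u) (torus_point \<theta>)) = case_prod (character u) (torus_point \<theta>)"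
  using character_real_on_torus[of "fst (torus_point \<theta>)" "snd (torus_point \<theta>)" u]
  by (simp add: complex_eq_iff torus_point_def)

lemma integral_unit_interval_cis:
  "integral {0..1} (\<lambda>x. cis (2 * pi * (of_int a * x))) = (if a = 0 then 1 else 0)"
proof (cases "a = 0")
  case False
  let ?c = "\<i> * of_real (2 * pi * of_int a)"
  let ?F = "\<lambda>x :: real. exp (?c * of_real x) / ?c"
  have cis: "cis (2 * pi * (of_int a * x)) = exp (?c * of_real x)" for x
    by (simp add: cis_conv_exp mult_ac)
  have "(?F has_vector_derivative exp (?c * of_real x)) (at x within {0..1})" for x
    by (rule has_vector_derivative_real_field) (use False in \<open>auto intro!: derivative_eq_intros\<close>)
  then have "((\<lambda>x. exp (?c * of_real x)) has_integral ?F 1 - ?F 0) {0..1}"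
    by (intro fundamental_theorem_of_calculus) auto
  moreover have "exp ?c = 1"
    using cis[of 1] cis_multiple_2pi[of "of_int a"] by simp
  ultimately show ?thesis
    using False by (simp add: cis integral_unique)
qed simp

text \<open>
  The orthogonality relations of the characters of the torus, by Fubini.
\<close>

lemma integral_torus_monomial:
  "integral (cbox 0 1) (torus_monomial d) = (if d = 0 then 1 else 0)"
proof -
  let ?h = "\<lambda>p :: real \<times> real. cis (2 * pi * (of_int (fst d) * fst p)) * cis (2 * pi * (of_int (snd d) * snd p))"
  let ?f = "\<lambda>p. indicator (cbox (0, 0) (1, 1)) p *\<^sub>R ?h p"
  have h: "continuous_on S ?h" for S
    by (intro continuous_intros)
  have meas: "?f \<in> borel_measurable borel"
    using borel_measurable_continuous_onI[OF h] by measurable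
  have int: "set_integrable lebesgue (cbox 0 1) (torus_monomial d)"
    by (intro absolutely_integrable_continuous continuous_intros)
  have inth: "set_integrable lebesgue (cbox (0, 0) (1, 1)) ?h"
    by (intro absolutely_integrable_continuous h)
  have vec: "?f (v$1, v$2) = indicator (cbox 0 1) v *\<^sub>R torus_monomial d v" for v :: "real^2"
  proof -
    have "(v$1, v$2) \<in> cbox (0, 0) (1, 1) \<longleftrightarrow> v \<in> cbox 0 1"
      by (auto simp: cbox_Pair_eq mem_box_cart forall_2)
    then show ?thesis
      by (simp add: torus_monomial_def cis_mult algebra_simps indicator_def)
  qed
  have "integral (cbox 0 1) (torus_monomial d) = integral\<^sup>L lborel ?f"
    unfolding lborel_integral_pair_eq_vec(2)[OF meas] vec
    using set_lebesgue_integral_eq_integral(2)[OF int] by (simp add: set_lebesgue_integral_def)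
  also have "\<dots> = integral\<^sup>L lebesgue ?f"
    using meas by (intro integral_completion[symmetric]) simp
  also have "\<dots> = integral (cbox (0, 0) (1, 1)) ?h"
    using set_lebesgue_integral_eq_integral(2)[OF inth] by (simp add: set_lebesgue_integral_def)
  also have "\<dots> = integral {0..1} (\<lambda>x. cis (2 * pi * (of_int (fst d) * x))) *
      integral {0..1} (\<lambda>y. cis (2 * pi * (of_int (snd d) * y)))"
    by (subst integral_prod_continuous[OF h]) (simp add: integral_mult_right integral_mult_left)
  finally show ?thesis
    by (simp add: integral_unit_interval_cis prod_eq_iff)
qed

text \<open>
  The function \<open>f\<close> is the Fourier transform of \<open>g\<close>. The sum over the edges at \<open>\<mu>\<close> produces the
  conjugate of the character as an additional factor under the integral, and the character is real.
\<close>

lemma adjacency_op_Fourier_coefficient: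
  assumes g: "continuous_on (cbox 0 1) g"
    and f: "\<And>\<mu>. f \<mu> = integral (cbox 0 1) (\<lambda>\<theta>. g \<theta> * cnj (torus_monomial \<mu> \<theta>))"
  shows "adjacency_op u f \<mu> =
    integral (cbox 0 1) (\<lambda>\<theta>. case_prod (character u) (torus_point \<theta>) * g \<theta> * cnj (torus_monomial \<mu> \<theta>))"
proof -
  let ?K = "Poly_Mapping.keys (weights u)" and ?c = "\<lambda>d. of_nat (Poly_Mapping.lookup (weights u) d)"
  have "adjacency_op u f \<mu> =
      (\<Sum>d\<in>?K. integral (cbox 0 1) (\<lambda>\<theta>. ?c d * (g \<theta> * cnj (torus_monomial (\<mu> + d) \<theta>))))"
    by (simp add: adjacency_op_eq_sum f integral_mult_right)
  also have "\<dots> = integral (cbox 0 1) (\<lambda>\<theta>. \<Sum>d\<in>?K. ?c d * (g \<theta> * cnj (torus_monomial (\<mu> + d) \<theta>)))"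
    by (intro integral_sum[symmetric] integrable_continuous continuous_intros g) auto
  also have "\<dots> = integral (cbox 0 1) (\<lambda>\<theta>.
      cnj (case_prod (character u) (torus_point \<theta>)) * g \<theta> * cnj (torus_monomial \<mu> \<theta>))"
    unfolding character_torus_point
    by (intro arg_cong[where f = "integral _"] ext)
      (simp add: torus_monomial_add sum_distrib_left sum_distrib_right mult_ac)
  finally show ?thesis
    unfolding cnj_character_torus_point .
qed

lemma adjacency_op_powers_Fourier_coefficient:
  "((adjacency_op u ^^ m) ((adjacency_op v ^^ n) (ell2_basis (0, 0)))) \<mu> =
    integral (cbox 0 1) (\<lambda>\<theta>. case_prod (character u) (torus_point \<theta>) ^ m *
      case_prod (character v) (torus_point \<theta>) ^ n * cnj (torus_monomial \<mu> \<theta>))"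
proof (induction m arbitrary: \<mu>)
  case 0
  show ?case
  proof (induction n arbitrary: \<mu>)
    case 0
    have "cnj (torus_monomial \<mu> \<theta>) = torus_monomial (- \<mu>) \<theta>" for \<theta>
      by (simp add: torus_monomial_def cis_cnj algebra_simps)
    then show ?case
      by (simp add: ell2_basis_def integral_torus_monomial flip: zero_prod_def)
  next
    case (Suc n)
    show ?case
      using adjacency_op_Fourier_coefficient[OF _ Suc, of v \<mu>]
      by (simp add: mult.assoc continuous_intros)
  qed
next
  case (Suc m)
  show ?case
    using adjacency_op_Fourier_coefficient[OF _ Suc, of u \<mu>]
    by (simp add: mult.assoc continuous_intros)
qed

lemma spectral_moment_eq_integral_torus:
  "ell2_inner ((adjacency_op u ^^ m) ((adjacency_op v ^^ n) (ell2_basis (0, 0)))) (ell2_basis (0, 0)) =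
    complex_of_real (integral (cbox 0 1) (\<lambda>\<theta>. case char_pair u v (torus_point \<theta>) of (s, t) \<Rightarrow> s ^ m * t ^ n))"
proof -
  let ?f = "(adjacency_op u ^^ m) ((adjacency_op v ^^ n) (ell2_basis (0, 0)))"
  let ?q = "\<lambda>\<theta>. case char_pair u v (torus_point \<theta>) of (s, t) \<Rightarrow> s ^ m * t ^ n"
  have re: "case_prod (character w) (torus_point \<theta>) = of_real (Re (case_prod (character w) (torus_point \<theta>)))" for w \<theta>
    using cnj_character_torus_point[of w \<theta>] by (simp add: complex_eq_iff)
  have q: "of_real (?q \<theta>) = case_prod (character u) (torus_point \<theta>) ^ m * case_prod (character v) (torus_point \<theta>) ^ n" for \<theta>
  proof -
    have pair: "char_pair u v w = (Re (case_prod (character u) w), Re (case_prod (character v) w))" for w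
      by (simp add: char_pair_def case_prod_unfold)
    show ?thesis
      by (simp only: pair prod.case of_real_mult of_real_power flip: re)
  qed
  have cont: "continuous_on S ?q" for S
    unfolding char_pair_def case_prod_unfold fst_conv snd_conv
    using continuous_on_character_torus_point[unfolded case_prod_unfold]
    by (intro continuous_intros) auto
  have "ell2_inner ?f (ell2_basis (0, 0)) = (\<Sum>\<^sub>\<infinity>\<mu>\<in>{(0, 0)}. ?f \<mu> * cnj (ell2_basis (0, 0) \<mu>))"
    unfolding ell2_inner_def by (rule infsum_cong_neutral) (auto simp: ell2_basis_def)
  also have "\<dots> = ?f (0, 0)"
    by (simp add: ell2_basis_def)
  also have "\<dots> = integral (cbox 0 1) (complex_of_real \<circ> ?q)"
    unfolding adjacency_op_powers_Fourier_coefficient by (simp add: o_def q torus_monomial_def)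
  also have "\<dots> = of_real (integral (cbox 0 1) ?q)"
    by (intro integral_linear integrable_continuous cont bounded_linear_of_real)
  finally show ?thesis .
qed

section \<open>Uniqueness of joint spectral measures\<close>

lemma differentiable_char_pair:
  "(\<lambda>\<theta>. fst (char_pair u v (torus_point \<theta>))) differentiable at \<theta>"
  "(\<lambda>\<theta>. snd (char_pair u v (torus_point \<theta>))) differentiable at \<theta>"
proof -
  have cos: "(\<lambda>\<theta>::real^2. cos (2 * pi * \<theta>$k)) differentiable at \<theta>" for k
    using has_derivative_cos_nth differentiable_def by blast
  have "(\<lambda>\<theta>. fst (char_pair Rho_x Rho_y (torus_point \<theta>))) differentiable at \<theta>"
    "(\<lambda>\<theta>. snd (char_pair Rho_x Rho_y (torus_point \<theta>))) differentiable at \<theta>"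
    "(\<lambda>\<theta>. snd (char_pair Rho_y Rho_z (torus_point \<theta>))) differentiable at \<theta>"
    unfolding char_pair_xy char_pair_yz fst_conv snd_conv
    by (intro differentiable_add differentiable_diff differentiable_mult differentiable_power cos
        differentiable_const)+
  then have "(\<lambda>\<theta>. Re (case_prod (character w) (torus_point \<theta>))) differentiable at \<theta>" for w
    by (cases w) (simp_all add: char_pair_def case_prod_unfold)
  then show "(\<lambda>\<theta>. fst (char_pair u v (torus_point \<theta>))) differentiable at \<theta>"
    "(\<lambda>\<theta>. snd (char_pair u v (torus_point \<theta>))) differentiable at \<theta>"
    by (simp_all add: char_pair_def case_prod_unfold)
qed

lemma continuous_on_char_pair:
  "continuous_on S (\<lambda>\<theta>. char_pair u v (torus_point \<theta>))"
proof -
  have "continuous_on S (\<lambda>\<theta>. (fst (char_pair u v (torus_point \<theta>)), snd (char_pair u v (torus_point \<theta>))))"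
    by (intro continuous_on_Pair continuous_at_imp_continuous_on ballI
        differentiable_imp_continuous_within differentiable_char_pair)
  then show ?thesis by simp
qed

text \<open>
  Reducing the angles modulo \<open>1\<close> exhibits the domain as the image of a compact square.
\<close>

lemma torus_point_fractional_part:
  "\<exists>\<theta>'\<in>cbox 0 1. torus_point \<theta>' = torus_point \<theta>"
proof
  let ?\<theta>' = "\<chi> i. frac (\<theta>$i)"
  show "?\<theta>' \<in> cbox 0 1"
    by (simp add: mem_box_cart less_imp_le frac_lt_1)
  have "cis (2 * pi * frac x) = cis (2 * pi * x)" for x
  proof -
    have "2 * pi * x = 2 * pi * frac x + 2 * pi * of_int \<lfloor>x\<rfloor>"
      by (simp add: frac_def algebra_simps)
    then show ?thesis
      by (simp add: cis_mult[symmetric])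
  qed
  then show "torus_point ?\<theta>' = torus_point \<theta>"
    by (simp add: torus_point_def)
qed

lemma compact_joint_dom: "compact (joint_dom u v)"
proof -
  have "joint_dom u v = (\<lambda>\<theta>. char_pair u v (torus_point \<theta>)) ` cbox 0 1"
    unfolding joint_dom_eq using torus_point_fractional_part by (auto simp: image_iff) metis
  then show ?thesis
    by (simp add: compact_continuous_image continuous_on_char_pair)
qed

lemma is_joint_spectral_measure_unique:
  assumes "is_joint_spectral_measure u v M" "is_joint_spectral_measure u v N"
  shows "M = N"
proof (rule finite_measures_eqI_moments[OF compact_joint_dom])
  show "(\<integral>(s, t). s ^ m * t ^ n \<partial>M) = (\<integral>(s, t). s ^ m * t ^ n \<partial>N)" for m n
    using assms unfolding is_joint_spectral_measure_def by (metis of_real_eq_iff)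
qed (use assms in \<open>auto simp: is_joint_spectral_measure_def\<close>)

section \<open>Densities with respect to the Jacobian\<close>

text \<open>
  The mechanism common to both pairs. The set \<open>C\<close> is a fundamental domain: \<open>\<Phi>\<close> is injective on it,
  and \<open>C\<close> contains a representative of every point at which \<open>\<Phi>\<close> is regular. The assumption \<open>fold\<close>
  says that \<open>\<Phi>\<close> is generically \<open>k\<close> to one. The density \<open>\<rho> = k |J|\<^sup>-\<^sup>1\<close> is supported on
  the image of \<open>C\<close>, and pulling it back to \<open>C\<close> gives the constant \<open>k\<close>.
\<close>

lemma is_joint_spectral_measure_density:
  fixes u v :: irrep and C :: "(real^2) set" and k :: real
  defines "\<Phi> \<equiv> \<lambda>\<theta>. char_pair u v (torus_point \<theta>)"
  assumes C: "C \<in> sets borel" "C \<subseteq> cbox 0 1" and k: "k \<ge> 0"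
    and inj: "inj_on \<Phi> C"
    and meas: "abs_jacobian u v \<in> borel_measurable (restrict_space borel (joint_dom u v))"
    and jac: "\<And>\<theta>. abs_jacobian u v (\<Phi> \<theta>) = \<bar>char_jacobian u v \<theta>\<bar>"
    and regular: "\<And>\<theta>. \<theta> \<in> C \<Longrightarrow> char_jacobian u v \<theta> \<noteq> 0"
    and cover: "\<And>\<theta>. char_jacobian u v \<theta> \<noteq> 0 \<Longrightarrow> \<Phi> \<theta> \<in> \<Phi> ` C"
    and fold: "\<And>h :: real \<times> real \<Rightarrow> real. continuous_on UNIV h \<Longrightarrow>
      integral (cbox 0 1) (\<lambda>\<theta>. h (\<Phi> \<theta>)) = k * integral C (\<lambda>\<theta>. h (\<Phi> \<theta>))"
  shows "is_joint_spectral_measure u v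
    (density (restrict_space lborel (joint_dom u v)) (\<lambda>p. ennreal (k * inverse (abs_jacobian u v p))))"
proof -
  let ?D = "joint_dom u v" and ?\<rho> = "\<lambda>p. k * inverse (abs_jacobian u v p)"
  let ?R = "restrict_space lborel ?D"
  let ?\<Psi> = "\<lambda>\<theta>. vector [fst (\<Phi> \<theta>), snd (\<Phi> \<theta>)] :: real^2"
  have D: "?D \<inter> space lborel \<in> sets lborel" "?D \<inter> space borel \<in> sets borel"
    using compact_imp_closed[OF compact_joint_dom[of u v]] by simp_all
  have sets_R: "sets ?R = sets (restrict_space borel ?D)"
    by (simp add: sets_restrict_space)
  have \<rho>_meas: "?\<rho> \<in> borel_measurable ?R"
  proof -
    have "abs_jacobian u v \<in> borel_measurable ?R"
      using meas measurable_cong_sets[OF sets_R refl] by blast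
    then show ?thesis by measurable
  qed
  have aj: "abs_jacobian u v p \<ge> 0" if "p \<in> ?D" for p
    using that jac by (auto simp: joint_dom_eq \<Phi>_def)
  have \<rho>_nonneg: "AE p in ?R. 0 \<le> ?\<rho> p"
    using k aj by (intro AE_I2) (simp add: space_restrict_space)
  have \<Psi>_der: "(?\<Psi> has_derivative frechet_derivative ?\<Psi> (at \<theta>)) (at \<theta> within C)" for \<theta>
  proof -
    have "(\<lambda>\<theta>. fst (\<Phi> \<theta>) *\<^sub>R axis 1 1 + snd (\<Phi> \<theta>) *\<^sub>R axis 2 1 :: real^2) differentiable at \<theta>"
      unfolding \<Phi>_def
      by (intro differentiable_add differentiable_scaleR differentiable_char_pair differentiable_const)
    also have "(\<lambda>\<theta>. fst (\<Phi> \<theta>) *\<^sub>R axis 1 1 + snd (\<Phi> \<theta>) *\<^sub>R axis 2 1 :: real^2) = ?\<Psi>"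
      by (auto simp: fun_eq_iff vec_eq_iff forall_2 axis_def)
    finally show ?thesis
      by (rule has_derivative_at_withinI[OF frechet_derivative_works[THEN iffD1]])
  qed
  have \<Psi>_det: "det (matrix (frechet_derivative ?\<Psi> (at \<theta>))) = char_jacobian u v \<theta>" for \<theta>
    by (simp add: char_jacobian_def jacobian_def \<Phi>_def)
  have \<Psi>_inj: "inj_on ?\<Psi> C"
  proof (rule inj_onI)
    fix \<theta> \<theta>' assume "\<theta> \<in> C" "\<theta>' \<in> C" "?\<Psi> \<theta> = ?\<Psi> \<theta>'"
    then show "\<theta> = \<theta>'"
      by (intro inj_onD[OF inj]) (simp_all add: vec_eq_iff forall_2 prod_eq_iff)
  qed
  have C_leb: "C \<in> sets lebesgue"
    using C(1) by simp
  have moment: "integrable (density ?R ?\<rho>) h \<and>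
      integral\<^sup>L (density ?R ?\<rho>) h = integral (cbox 0 1) (\<lambda>\<theta>. h (\<Phi> \<theta>))"
    if h: "continuous_on UNIV h" for h :: "real \<times> real \<Rightarrow> real"
  proof -
    define f where "f p = indicator ?D p *\<^sub>R (?\<rho> p *\<^sub>R h p)" for p
    define F where "F v = f (v$1, v$2)" for v :: "real^2"
    have h_meas: "h \<in> borel_measurable ?R"
      using borel_measurable_continuous_onI[OF h] by (intro measurable_restrict_space1) simp
    have f_meas: "f \<in> borel_measurable borel"
    proof -
      have "(\<lambda>p. ?\<rho> p *\<^sub>R h p) \<in> borel_measurable ?R"
        using \<rho>_meas h_meas by measurable
      then have "f \<in> borel_measurable lborel"
        unfolding f_def by (rule borel_measurable_restrict_space_iff[OF D(1), THEN iffD1])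
      then show ?thesis by simp
    qed
    have f_density: "integrable (density ?R ?\<rho>) h \<longleftrightarrow> integrable lborel f"
      "integral\<^sup>L (density ?R ?\<rho>) h = integral\<^sup>L lborel f"
      unfolding f_def integrable_density[OF h_meas \<rho>_meas \<rho>_nonneg] integral_density[OF h_meas \<rho>_meas \<rho>_nonneg]
        integrable_restrict_space[OF D(1)] integral_restrict_space[OF D(1)] by rule+
    \<comment> \<open>Outside the image of the chamber the Jacobian vanishes, and the density with it.\<close>
    have F_supp: "F w = indicator (?\<Psi> ` C) w *\<^sub>R F w" for w
    proof (cases "F w = 0")
      case False
      then have "(w$1, w$2) \<in> ?D" and j: "abs_jacobian u v (w$1, w$2) \<noteq> 0"
        by (auto simp: F_def f_def indicator_def split: if_splits)
      then obtain \<theta> where \<theta>: "(w$1, w$2) = \<Phi> \<theta>"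
        by (auto simp: joint_dom_eq \<Phi>_def)
      then have "\<Phi> \<theta> \<in> \<Phi> ` C"
        using j by (intro cover) (simp add: jac)
      then obtain \<theta>' where "\<theta>' \<in> C" "(w$1, w$2) = \<Phi> \<theta>'"
        unfolding \<theta> by blast
      moreover from this have "w = ?\<Psi> \<theta>'"
        by (simp add: vec_eq_iff forall_2 flip: \<open>(w$1, w$2) = \<Phi> \<theta>'\<close>)
      ultimately show ?thesis by simp
    qed simp
    have pullback: "\<bar>det (matrix (frechet_derivative ?\<Psi> (at \<theta>)))\<bar> * F (?\<Psi> \<theta>) = k * h (\<Phi> \<theta>)"
      if "\<theta> \<in> C" for \<theta>
    proof -
      have "\<Phi> \<theta> \<in> ?D"
        by (auto simp: joint_dom_eq \<Phi>_def)
      then show ?thesis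
        using regular[OF that] by (simp add: F_def f_def \<Psi>_det jac)
    qed
    have "(\<lambda>\<theta>. k * h (\<Phi> \<theta>)) absolutely_integrable_on cbox 0 1"
      unfolding \<Phi>_def
      by (intro absolutely_integrable_continuous continuous_intros continuous_on_compose2[OF h]
          continuous_on_char_pair) auto
    then have "(\<lambda>\<theta>. k * h (\<Phi> \<theta>)) absolutely_integrable_on C"
      by (rule set_integrable_subset) (use C_leb C in auto)
    then have "(\<lambda>\<theta>. \<bar>det (matrix (frechet_derivative ?\<Psi> (at \<theta>)))\<bar> * F (?\<Psi> \<theta>)) absolutely_integrable_on C"
      by (subst set_integrable_cong[OF refl refl pullback]) auto
    note cov = has_absolute_integral_change_of_variables_scalar[OF C_leb \<Psi>_der \<Psi>_inj this]
    have F_int: "integrable lebesgue F" "integral\<^sup>L lebesgue F = integral (?\<Psi> ` C) F"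
      using cov(1) set_lebesgue_integral_eq_integral(2)[OF cov(1)]
      unfolding set_integrable_def set_lebesgue_integral_def F_supp[symmetric] by simp_all
    have "integral (?\<Psi> ` C) F = integral C (\<lambda>\<theta>. k * h (\<Phi> \<theta>))"
      unfolding cov(2) by (rule integral_cong) (rule pullback)
    also have "\<dots> = integral (cbox 0 1) (\<lambda>\<theta>. h (\<Phi> \<theta>))"
      by (simp add: fold[OF h])
    finally show ?thesis
      using F_int unfolding f_density lborel_integral_pair_eq_vec[OF f_meas] F_def by simp
  qed
  have "continuous_on UNIV (\<lambda>(s, t). s ^ m * t ^ n :: real)" for m n
    unfolding case_prod_unfold by (intro continuous_intros)
  from moment[OF this] show ?thesis
    unfolding is_joint_spectral_measure_def spectral_moment_eq_integral_torus
    by (simp add: sets_R \<Phi>_def)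
qed

section \<open>Folding the torus to a chamber\<close>

text \<open>
  The reflections in the walls. The last one composes the swap with \<open>\<theta> \<mapsto> 1/2 - \<theta>\<close>, which negates the
  cosines.
\<close>

lemma affine_reflection_wall:
  "affine_reflection (vector [1, 0] :: real^2) (1/2) \<theta> = vector [1 - \<theta>$1, \<theta>$2]"
  "affine_reflection (vector [0, 1] :: real^2) (1/2) \<theta> = vector [\<theta>$1, 1 - \<theta>$2]"
  "affine_reflection (vector [1, -1] :: real^2) 0 \<theta> = vector [\<theta>$2, \<theta>$1]"
  "affine_reflection (vector [1, 1] :: real^2) (1/2) \<theta> = vector [1/2 - \<theta>$2, 1/2 - \<theta>$1]"
  by (simp_all add: affine_reflection_def vec_eq_iff forall_2 inner_vec_def sum_2 field_simps)

definition xy_chamber :: "(real^2) set" where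
  "xy_chamber = {\<theta>. 0 < \<theta>$1 \<and> \<theta>$1 < \<theta>$2 \<and> \<theta>$2 < 1/2}"

definition yz_chamber :: "(real^2) set" where
  "yz_chamber = {\<theta>. 0 < \<theta>$1 \<and> \<theta>$1 < \<theta>$2 \<and> \<theta>$1 + \<theta>$2 < 1/2}"

lemma open_chambers: "open xy_chamber" "open yz_chamber"
  unfolding xy_chamber_def yz_chamber_def
  by (intro open_Collect_conj open_Collect_less continuous_intros)+

lemma chambers_subset_unit_square: "yz_chamber \<subseteq> xy_chamber" "xy_chamber \<subseteq> cbox 0 1"
  by (auto simp: xy_chamber_def yz_chamber_def mem_box_cart forall_2)

lemma cos_pi_shifts:
  "cos (2 * pi * (1 - t)) = cos (2 * pi * t)" "cos (2 * pi * (1/2 - t)) = - cos (2 * pi * t)"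
  for t :: real
  by (simp_all add: right_diff_distrib cos_diff)

text \<open>
  Three folds, first in each of the two angles and then along the diagonal, halve the domain of
  integration each time.
\<close>

lemma integral_unit_square_eq_8_chamber:
  fixes F :: "real^2 \<Rightarrow> real"
  assumes cont: "continuous_on (cbox 0 1) F"
    and F: "\<And>\<theta>. F \<theta> = G (cos (2 * pi * \<theta>$1)) (cos (2 * pi * \<theta>$2))"
    and G: "\<And>a b. G b a = G a b"
  shows "integral (cbox 0 1) F = 8 * integral xy_chamber F"
proof -
  let ?A0 = "{\<theta> :: real^2. 0 < \<theta>$1 \<and> \<theta>$1 < 1 \<and> 0 < \<theta>$2 \<and> \<theta>$2 < 1}"
  let ?A1 = "{\<theta> :: real^2. 0 < \<theta>$1 \<and> \<theta>$1 < 1/2 \<and> 0 < \<theta>$2 \<and> \<theta>$2 < 1}"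
  let ?A2 = "{\<theta> :: real^2. 0 < \<theta>$1 \<and> \<theta>$1 < 1/2 \<and> 0 < \<theta>$2 \<and> \<theta>$2 < 1/2}"
  let ?v1 = "vector [1, 0] :: real^2" and ?v2 = "vector [0, 1] :: real^2" and ?v3 = "vector [1, -1] :: real^2"
  have op: "open ?A0" "open ?A1" "open ?A2"
    by (intro open_Collect_conj open_Collect_less continuous_intros)+
  then have A: "?A0 \<in> sets lebesgue" "?A1 \<in> sets lebesgue" "?A2 \<in> sets lebesgue"
    by simp_all
  have nz: "?v1 \<noteq> 0" "?v2 \<noteq> 0" "?v3 \<noteq> 0"
    by (simp_all add: vec_eq_iff forall_2)
  have "F absolutely_integrable_on cbox 0 1"
    by (rule absolutely_integrable_continuous[OF cont])
  then have int: "F absolutely_integrable_on ?A0" "F absolutely_integrable_on ?A1" "F absolutely_integrable_on ?A2"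
    by (rule set_integrable_subset; use A in \<open>auto simp: mem_box_cart forall_2\<close>)+
  have "integral (cbox 0 1) F = integral ?A0 F"
  proof -
    have "?A0 = box 0 1"
      by (auto simp: mem_box_cart forall_2)
    then show ?thesis
      using integral_open_interval by metis
  qed
  also have "\<dots> = 2 * integral ?A1 F"
  proof -
    have "{\<theta> \<in> ?A0. ?v1 \<bullet> \<theta> < 1/2} = ?A1"
      by (auto simp: inner_vec_def sum_2)
    then show ?thesis
      using integral_fold_affine_reflection[OF nz(1) int(1) A(1), of "1/2"]
      unfolding affine_reflection_wall by (auto simp: F cos_pi_shifts)
  qed
  also have "integral ?A1 F = 2 * integral ?A2 F"
  proof -
    have "{\<theta> \<in> ?A1. ?v2 \<bullet> \<theta> < 1/2} = ?A2"
      by (auto simp: inner_vec_def sum_2)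
    then show ?thesis
      using integral_fold_affine_reflection[OF nz(2) int(2) A(2), of "1/2"]
      unfolding affine_reflection_wall by (auto simp: F cos_pi_shifts)
  qed
  also have "integral ?A2 F = 2 * integral xy_chamber F"
  proof -
    have "{\<theta> \<in> ?A2. ?v3 \<bullet> \<theta> < 0} = xy_chamber"
      by (auto simp: inner_vec_def sum_2 xy_chamber_def)
    then show ?thesis
      using integral_fold_affine_reflection[OF nz(3) int(3) A(3), of 0]
      unfolding affine_reflection_wall by (auto simp: F G)
  qed
  finally show ?thesis by simp
qed

text \<open>
  If the integrand is also invariant under negating both cosines, the triangle can be folded once
  more.
\<close>

lemma integral_unit_square_eq_16_chamber:
  fixes F :: "real^2 \<Rightarrow> real"
  assumes cont: "continuous_on (cbox 0 1) F"
    and F: "\<And>\<theta>. F \<theta> = G (cos (2 * pi * \<theta>$1)) (cos (2 * pi * \<theta>$2))"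
    and G: "\<And>a b. G b a = G a b" "\<And>a b. G (- a) (- b) = G a b"
  shows "integral (cbox 0 1) F = 16 * integral yz_chamber F"
proof -
  let ?v = "vector [1, 1] :: real^2"
  have nz: "?v \<noteq> 0"
    by (simp add: vec_eq_iff forall_2)
  have C: "xy_chamber \<in> sets lebesgue"
    using open_chambers(1) by simp
  have int: "F absolutely_integrable_on xy_chamber"
    using absolutely_integrable_continuous[OF cont] C chambers_subset_unit_square(2)
    by (rule set_integrable_subset)
  have "{\<theta> \<in> xy_chamber. ?v \<bullet> \<theta> < 1/2} = yz_chamber"
    by (auto simp: inner_vec_def sum_2 xy_chamber_def yz_chamber_def)
  then have "integral xy_chamber F = 2 * integral yz_chamber F"
    using integral_fold_affine_reflection[OF nz int C, of "1/2"]
    unfolding affine_reflection_wall by (auto simp: F G cos_pi_shifts xy_chamber_def)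
  then show ?thesis
    using integral_unit_square_eq_8_chamber[OF cont F G(1)] by simp
qed

lemma cos_on_xy_chamber:
  assumes "\<theta> \<in> xy_chamber"
  shows "cos (2 * pi * \<theta>$2) < cos (2 * pi * \<theta>$1)"
    and "sin (2 * pi * \<theta>$1) > 0" "sin (2 * pi * \<theta>$2) > 0"
  using assms
  by (auto simp: xy_chamber_def intro!: cos_monotone_0_pi sin_gt_zero)

lemma cos_on_yz_chamber:
  assumes "\<theta> \<in> yz_chamber"
  shows "\<bar>cos (2 * pi * \<theta>$2)\<bar> < cos (2 * pi * \<theta>$1)"
proof -
  have "cos (pi - 2 * pi * \<theta>$2) < cos (2 * pi * \<theta>$1)"
  proof (rule cos_monotone_0_pi)
    have "2 * pi * (\<theta>$1 + \<theta>$2) < 2 * pi * (1/2)"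
      using assms by (intro mult_strict_left_mono) (auto simp: yz_chamber_def)
    then show "2 * pi * \<theta>$1 < pi - 2 * pi * \<theta>$2"
      by (simp add: algebra_simps)
  qed (use assms in \<open>auto simp: yz_chamber_def\<close>)
  then show ?thesis
    using cos_on_xy_chamber(1)[of \<theta>] assms chambers_subset_unit_square by auto
qed

lemma xy_chamber_if_cos:
  assumes "-1 < b" "b < a" "a < 1"
  obtains \<theta> where "\<theta> \<in> xy_chamber" "cos (2 * pi * \<theta>$1) = a" "cos (2 * pi * \<theta>$2) = b"
proof
  let ?\<theta> = "vector [arccos a / (2 * pi), arccos b / (2 * pi)] :: real^2"
  have "0 < arccos a" "arccos a < arccos b" "arccos b < pi"
    using assms arccos_lt_bounded[of a] arccos_lt_bounded[of b] arccos_less_arccos[of b a] by auto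
  then show "?\<theta> \<in> xy_chamber"
    by (simp add: xy_chamber_def divide_simps)
qed (use assms in auto)

lemma yz_chamber_if_cos:
  assumes "\<bar>b\<bar> < a" "a < 1"
  obtains \<theta> where "\<theta> \<in> yz_chamber" "cos (2 * pi * \<theta>$1) = a" "cos (2 * pi * \<theta>$2) = b"
proof -
  obtain \<theta> where \<theta>: "\<theta> \<in> xy_chamber" "cos (2 * pi * \<theta>$1) = a" "cos (2 * pi * \<theta>$2) = b"
  proof (rule xy_chamber_if_cos)
    show "-1 < b" "b < a" "a < 1"
      using assms by auto
  qed
  have "\<theta>$1 + \<theta>$2 < 1/2"
  proof (rule ccontr)
    assume "\<not> ?thesis"
    then have "2 * pi * (1/2 - \<theta>$2) \<le> 2 * pi * \<theta>$1"
      by (intro mult_left_mono) auto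
    moreover have "0 \<le> 2 * pi * (1/2 - \<theta>$2)" "2 * pi * \<theta>$1 \<le> pi"
      using \<theta>(1) by (auto simp: xy_chamber_def)
    ultimately have "cos (2 * pi * \<theta>$1) \<le> cos (2 * pi * (1/2 - \<theta>$2))"
      by (intro cos_monotone_0_pi_le)
    then show False
      using \<theta> assms unfolding cos_pi_shifts by auto
  qed
  then have "\<theta> \<in> yz_chamber"
    using \<theta>(1) by (simp add: xy_chamber_def yz_chamber_def)
  then show ?thesis
    using \<theta> that by blast
qed

text \<open>
  The sum and the product determine the two cosines up to order, and on the chamber the first cosine is
  the larger one.
\<close>

lemma xy_chamber_eqI:
  assumes "\<theta> \<in> xy_chamber" "\<theta>' \<in> xy_chamber"
    and sum: "cos (2 * pi * \<theta>$1) + cos (2 * pi * \<theta>$2) = cos (2 * pi * \<theta>'$1) + cos (2 * pi * \<theta>'$2)"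
    and prod: "cos (2 * pi * \<theta>$1) * cos (2 * pi * \<theta>$2) = cos (2 * pi * \<theta>'$1) * cos (2 * pi * \<theta>'$2)"
  shows "\<theta> = \<theta>'"
proof -
  have vieta: "a = a' \<and> b = b'" if "a + b = a' + b'" "a * b = a' * b'" "b < a" "b' < a'" for a b a' b' :: real
  proof -
    have "(a - a') * (a - b') = 0"
      using that(1,2) by algebra
    then show ?thesis
      using that by auto
  qed
  have inj: "s = t" if "cos (2 * pi * s) = cos (2 * pi * t)" "0 < s" "s < 1/2" "0 < t" "t < 1/2" for s t
    using cos_inj_pi[of "2 * pi * s" "2 * pi * t"] that by auto
  show ?thesis
    using vieta[OF sum prod cos_on_xy_chamber(1)[OF assms(1)] cos_on_xy_chamber(1)[OF assms(2)]] assms(1,2)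
      inj[of "\<theta>$1" "\<theta>'$1"] inj[of "\<theta>$2" "\<theta>'$2"]
    by (auto simp: vec_eq_iff forall_2 xy_chamber_def)
qed

lemma abs_cos_less_1_if_sin_nonzero:
  assumes "sin t \<noteq> (0::real)"
  shows "\<bar>cos t\<bar> < 1"
proof -
  have "(cos t)\<^sup>2 < 1"
    using assms sin_cos_squared_add[of t] by (smt (verit) zero_less_power2)
  then show ?thesis
    by (simp add: abs_square_less_1)
qed

section \<open>The joint spectral measures of the two pairs\<close>

text \<open>
  The explicit radicand is the square of \<open>8 sin (2\<pi>\<theta>\<^sub>1) sin (2\<pi>\<theta>\<^sub>2) (cos (2\<pi>\<theta>\<^sub>1) - cos (2\<pi>\<theta>\<^sub>2))\<close>, so the
  absolute Jacobian at a point of the domain can be computed at any of its preimages.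
\<close>

lemma abs_jacobian_char_pair_xy:
  "abs_jacobian Rho_x Rho_y (char_pair Rho_x Rho_y (torus_point \<theta>)) = \<bar>char_jacobian Rho_x Rho_y \<theta>\<bar>"
proof -
  define S1 S2 C1 C2 where d: "S1 = sin (2 * pi * \<theta>$1)" "S2 = sin (2 * pi * \<theta>$2)"
    "C1 = cos (2 * pi * \<theta>$1)" "C2 = cos (2 * pi * \<theta>$2)"
  obtain x y where p: "char_pair Rho_x Rho_y (torus_point \<theta>) = (x, y)"
    by fastforce
  have S: "S1\<^sup>2 = 1 - C1\<^sup>2" "S2\<^sup>2 = 1 - C2\<^sup>2"
    by (simp_all add: d sin_squared_eq)
  have xy: "x = 2 * C1 + 2 * C2" "y = 1 + 4 * C1 * C2"
    using p by (auto simp: char_pair_xy d)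
  have "(8 * S1 * S2 * (C1 - C2))\<^sup>2 = 64 * S1\<^sup>2 * S2\<^sup>2 * (C1 - C2)\<^sup>2"
    by (simp add: power_mult_distrib)
  also have "\<dots> = (y + 2 * x + 3) * (y - 2 * x + 3) * (x\<^sup>2 - 4 * y + 4)"
    unfolding S xy by algebra
  finally have "sqrt ((y + 2 * x + 3) * (y - 2 * x + 3) * (x\<^sup>2 - 4 * y + 4)) = \<bar>8 * S1 * S2 * (C1 - C2)\<bar>"
    by (metis real_sqrt_abs)
  moreover have "(x, y) \<in> joint_dom Rho_x Rho_y"
    unfolding joint_dom_eq p[symmetric] by blast
  ultimately show ?thesis
    by (simp add: p abs_jacobian_xy char_jacobian_xy d abs_mult)
qed

lemma abs_jacobian_char_pair_yz:
  "abs_jacobian Rho_y Rho_z (char_pair Rho_y Rho_z (torus_point \<theta>)) = \<bar>char_jacobian Rho_y Rho_z \<theta>\<bar>"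
proof -
  define S1 S2 C1 C2 where d: "S1 = sin (2 * pi * \<theta>$1)" "S2 = sin (2 * pi * \<theta>$2)"
    "C1 = cos (2 * pi * \<theta>$1)" "C2 = cos (2 * pi * \<theta>$2)"
  obtain y z where p: "char_pair Rho_y Rho_z (torus_point \<theta>) = (y, z)"
    by fastforce
  have S: "S1\<^sup>2 = 1 - C1\<^sup>2" "S2\<^sup>2 = 1 - C2\<^sup>2"
    by (simp_all add: d sin_squared_eq)
  have yz: "y = 1 + 4 * C1 * C2" "z = 4 * C1\<^sup>2 + 4 * C2\<^sup>2 - 2 + 4 * C1 * C2"
    using p by (auto simp: char_pair_yz d)
  have "(16 * S1 * S2 * (C2\<^sup>2 - C1\<^sup>2))\<^sup>2 = 256 * S1\<^sup>2 * S2\<^sup>2 * (C2\<^sup>2 - C1\<^sup>2)\<^sup>2"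
    by (simp add: power_mult_distrib)
  also have "\<dots> = (z - 3 * y + 5) * (z + y + 1) * (y\<^sup>2 + 2 * y + 5 - 4 * z)"
    unfolding S yz by algebra
  finally have "sqrt ((z - 3 * y + 5) * (z + y + 1) * (y\<^sup>2 + 2 * y + 5 - 4 * z)) = \<bar>16 * S1 * S2 * (C2\<^sup>2 - C1\<^sup>2)\<bar>"
    by (metis real_sqrt_abs)
  moreover have "(y, z) \<in> joint_dom Rho_y Rho_z"
    unfolding joint_dom_eq p[symmetric] by blast
  ultimately show ?thesis
    by (simp add: p abs_jacobian_yz char_jacobian_yz d abs_mult)
qed

lemma borel_measurable_abs_jacobian:
  "abs_jacobian Rho_x Rho_y \<in> borel_measurable (restrict_space borel (joint_dom Rho_x Rho_y))"
  "abs_jacobian Rho_y Rho_z \<in> borel_measurable (restrict_space borel (joint_dom Rho_y Rho_z))"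
proof -
  let ?f = "\<lambda>(x, y). 4 * pi\<^sup>2 * sqrt ((y + 2 * x + 3) * (y - 2 * x + 3) * (x\<^sup>2 - 4 * y + 4))"
  let ?g = "\<lambda>(y, z). 8 * pi\<^sup>2 * sqrt ((z - 3 * y + 5) * (z + y + 1) * (y\<^sup>2 + 2 * y + 5 - 4 * z))"
  have "?f \<in> borel_measurable borel" "?g \<in> borel_measurable borel"
    unfolding case_prod_unfold by (intro borel_measurable_continuous_onI continuous_intros)+
  note meas = this[THEN measurable_restrict_space1]
  show "abs_jacobian Rho_x Rho_y \<in> borel_measurable (restrict_space borel (joint_dom Rho_x Rho_y))"
    by (rule measurable_cong[THEN iffD2, OF _ meas(1)]) (auto simp: space_restrict_space abs_jacobian_xy)
  show "abs_jacobian Rho_y Rho_z \<in> borel_measurable (restrict_space borel (joint_dom Rho_y Rho_z))"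
    by (rule measurable_cong[THEN iffD2, OF _ meas(2)]) (auto simp: space_restrict_space abs_jacobian_yz)
qed

text \<open>
  Sorting the two cosines moves any regular point into the chamber.
\<close>

lemma is_joint_spectral_measure_xy:
  "is_joint_spectral_measure Rho_x Rho_y
    (density (restrict_space lborel (joint_dom Rho_x Rho_y))
      (\<lambda>p. ennreal (8 * inverse (abs_jacobian Rho_x Rho_y p))))"
proof (rule is_joint_spectral_measure_density[where C = xy_chamber])
  show "inj_on (\<lambda>\<theta>. char_pair Rho_x Rho_y (torus_point \<theta>)) xy_chamber"
    by (intro inj_onI xy_chamber_eqI) (auto simp: char_pair_xy)
  show "char_jacobian Rho_x Rho_y \<theta> \<noteq> 0" if "\<theta> \<in> xy_chamber" for \<theta>
    using cos_on_xy_chamber[OF that] by (simp add: char_jacobian_xy)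
  show "char_pair Rho_x Rho_y (torus_point \<theta>) \<in> (\<lambda>\<theta>. char_pair Rho_x Rho_y (torus_point \<theta>)) ` xy_chamber"
    if "char_jacobian Rho_x Rho_y \<theta> \<noteq> 0" for \<theta>
  proof -
    define a b where ab: "a = cos (2 * pi * \<theta>$1)" "b = cos (2 * pi * \<theta>$2)"
    have "\<bar>a\<bar> < 1" "\<bar>b\<bar> < 1" "a \<noteq> b"
      using that by (auto simp: ab char_jacobian_xy abs_cos_less_1_if_sin_nonzero)
    then obtain \<theta>' where "\<theta>' \<in> xy_chamber" "cos (2 * pi * \<theta>'$1) = max a b" "cos (2 * pi * \<theta>'$2) = min a b"
      by (elim xy_chamber_if_cos[of "min a b" "max a b", rotated 3]) auto
    moreover from this have "char_pair Rho_x Rho_y (torus_point \<theta>') = char_pair Rho_x Rho_y (torus_point \<theta>)"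
      by (auto simp: char_pair_xy max_def min_def simp flip: ab)
    ultimately show ?thesis
      by (metis image_eqI)
  qed
  show "integral (cbox 0 1) (\<lambda>\<theta>. h (char_pair Rho_x Rho_y (torus_point \<theta>))) =
      8 * integral xy_chamber (\<lambda>\<theta>. h (char_pair Rho_x Rho_y (torus_point \<theta>)))"
    if "continuous_on UNIV h" for h :: "real \<times> real \<Rightarrow> real"
  proof (rule integral_unit_square_eq_8_chamber[where G = "\<lambda>a b. h (2 * a + 2 * b, 1 + 4 * a * b)"])
    show "continuous_on (cbox 0 1) (\<lambda>\<theta>. h (char_pair Rho_x Rho_y (torus_point \<theta>)))"
      by (rule continuous_on_compose2[OF that continuous_on_char_pair]) simp
  qed (simp_all add: char_pair_xy mult_ac add_ac)
qed (use open_chambers chambers_subset_unit_square in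
    \<open>simp_all add: borel_measurable_abs_jacobian abs_jacobian_char_pair_xy\<close>)

text \<open>
  The two coordinates determine the product and the sum of the squares of the cosines, hence the sum of
  the cosines up to sign; the sum is positive on this chamber. A regular point is moved into the chamber by
  putting the cosine of larger absolute value first and making it positive through a common change
  of sign.
\<close>

lemma is_joint_spectral_measure_yz:
  "is_joint_spectral_measure Rho_y Rho_z
    (density (restrict_space lborel (joint_dom Rho_y Rho_z))
      (\<lambda>p. ennreal (16 * inverse (abs_jacobian Rho_y Rho_z p))))"
proof (rule is_joint_spectral_measure_density[where C = yz_chamber])
  show "inj_on (\<lambda>\<theta>. char_pair Rho_y Rho_z (torus_point \<theta>)) yz_chamber"
  proof (rule inj_onI)
    fix \<theta> \<theta>' :: "real^2"
    assume C: "\<theta> \<in> yz_chamber" "\<theta>' \<in> yz_chamber"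
      and eq: "char_pair Rho_y Rho_z (torus_point \<theta>) = char_pair Rho_y Rho_z (torus_point \<theta>')"
    define a b a' b' where ab: "a = cos (2 * pi * \<theta>$1)" "b = cos (2 * pi * \<theta>$2)"
      "a' = cos (2 * pi * \<theta>'$1)" "b' = cos (2 * pi * \<theta>'$2)"
    have prod: "a * b = a' * b'" and "a\<^sup>2 + b\<^sup>2 = a'\<^sup>2 + b'\<^sup>2"
      using eq by (auto simp: char_pair_yz ab)
    then have "(a + b)\<^sup>2 = (a' + b')\<^sup>2"
      by (simp add: power2_sum mult.assoc)
    moreover have "a + b > 0" "a' + b' > 0"
      using cos_on_yz_chamber[OF C(1)] cos_on_yz_chamber[OF C(2)] by (auto simp: ab)
    ultimately have "a + b = a' + b'"
      by (simp add: power2_eq_iff_nonneg)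
    then show "\<theta> = \<theta>'"
      using C chambers_subset_unit_square(1) prod by (intro xy_chamber_eqI) (auto simp: ab)
  qed
  show "char_jacobian Rho_y Rho_z \<theta> \<noteq> 0" if "\<theta> \<in> yz_chamber" for \<theta>
  proof -
    have "(cos (2 * pi * \<theta>$2))\<^sup>2 \<noteq> (cos (2 * pi * \<theta>$1))\<^sup>2"
      using cos_on_yz_chamber[OF that] by (auto simp: power2_eq_iff)
    then show ?thesis
      using cos_on_xy_chamber[of \<theta>] that chambers_subset_unit_square(1) by (auto simp: char_jacobian_yz)
  qed
  show "char_pair Rho_y Rho_z (torus_point \<theta>) \<in> (\<lambda>\<theta>. char_pair Rho_y Rho_z (torus_point \<theta>)) ` yz_chamber"
    if "char_jacobian Rho_y Rho_z \<theta> \<noteq> 0" for \<theta>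
  proof -
    define a b where ab: "a = cos (2 * pi * \<theta>$1)" "b = cos (2 * pi * \<theta>$2)"
    have "\<bar>a\<bar> < 1" "\<bar>b\<bar> < 1" "b\<^sup>2 \<noteq> a\<^sup>2"
      using that by (auto simp: ab char_jacobian_yz abs_cos_less_1_if_sin_nonzero)
    then have neq: "\<bar>a\<bar> \<noteq> \<bar>b\<bar>"
      by (metis power2_abs)
    define a' b' where ab': "a' = (if \<bar>b\<bar> < \<bar>a\<bar> then \<bar>a\<bar> else \<bar>b\<bar>)"
      "b' = (if \<bar>b\<bar> < \<bar>a\<bar> then sgn a * b else sgn b * a)"
    have "\<bar>b'\<bar> < a'" "a' < 1"
      using neq \<open>\<bar>a\<bar> < 1\<close> \<open>\<bar>b\<bar> < 1\<close> by (auto simp: ab' abs_mult sgn_if)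
    then obtain \<theta>' where "\<theta>' \<in> yz_chamber" "cos (2 * pi * \<theta>'$1) = a'" "cos (2 * pi * \<theta>'$2) = b'"
      by (rule yz_chamber_if_cos)
    moreover from this have "char_pair Rho_y Rho_z (torus_point \<theta>') = char_pair Rho_y Rho_z (torus_point \<theta>)"
      using neq by (auto simp: char_pair_yz ab' abs_if sgn_if simp flip: ab split: if_splits)
    ultimately show ?thesis
      by (metis image_eqI)
  qed
  show "integral (cbox 0 1) (\<lambda>\<theta>. h (char_pair Rho_y Rho_z (torus_point \<theta>))) =
      16 * integral yz_chamber (\<lambda>\<theta>. h (char_pair Rho_y Rho_z (torus_point \<theta>)))"
    if "continuous_on UNIV h" for h :: "real \<times> real \<Rightarrow> real"
  proof (rule integral_unit_square_eq_16_chamber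
      [where G = "\<lambda>a b. h (1 + 4 * a * b, 4 * a\<^sup>2 + 4 * b\<^sup>2 - 2 + 4 * a * b)"])
    show "continuous_on (cbox 0 1) (\<lambda>\<theta>. h (char_pair Rho_y Rho_z (torus_point \<theta>)))"
      by (rule continuous_on_compose2[OF that continuous_on_char_pair]) simp
  qed (simp_all add: char_pair_yz mult_ac add_ac)
qed (use open_chambers chambers_subset_unit_square in
    \<open>auto simp: borel_measurable_abs_jacobian abs_jacobian_char_pair_yz\<close>)

lemma joint_spectral_measure_eqI:
  assumes "is_joint_spectral_measure u v M"
  shows "(\<exists>!M. is_joint_spectral_measure u v M) \<and> joint_spectral_measure u v = M"
  unfolding joint_spectral_measure_def
  using assms is_joint_spectral_measure_unique by (blast intro: the_equality)

theorem theorem2p1: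
  shows "(\<exists>!M. is_joint_spectral_measure Rho_x Rho_y M) \<and>
    joint_spectral_measure Rho_x Rho_y =
      density (restrict_space lborel (joint_dom Rho_x Rho_y))
        (\<lambda>p. ennreal (8 * inverse (abs_jacobian Rho_x Rho_y p))) \<and>
    (\<exists>!M. is_joint_spectral_measure Rho_y Rho_z M) \<and>
    joint_spectral_measure Rho_y Rho_z =
      density (restrict_space lborel (joint_dom Rho_y Rho_z))
        (\<lambda>p. ennreal (16 * inverse (abs_jacobian Rho_y Rho_z p)))"
  using joint_spectral_measure_eqI[OF is_joint_spectral_measure_xy]
    joint_spectral_measure_eqI[OF is_joint_spectral_measure_yz] by simp

end
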